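(* Let $\{X_t\},\{d_t\},\{\widehat r_t\}$ be generated by the algorithm ERSO-FW applied to $\min_{X\in S_n}f(X)$, with step-size either $\eta_t=\frac2{t+1}$ for all $t\ge1$, or exact line search $\eta_t\in\arg\min_{\eta\in[0,1]}f((1-\eta)X_{t-1}+\eta\widehat Y_t)$ for all $t\ge1$. Let $r_t:=r_{d_{t-1}}(X_{t-1})$ denote the thresholding rank and $\widehat r_t$ the efficient rank at iteration $t$. Then: (i) $\widehat r_t\le r_t\le r^*$ for all $t\ge1$; (ii) $r_t=r^*$ for all $t\ge T_0:=\dfrac{72L}{\mu\lambda_{r^*}^2}$; (iii) $\widehat r_t=r_t=r^*$ for all $t\ge T_0':=T_0+r^*$.
   Context: $\mathbb{S}^n$ is the space of real symmetric $n\times n$ matrices with the trace inner product and Frobenius norm $\|\cdot\|_F$. $S_n=\{X\in\mathbb{S}^n : \operatorname{tr}(X)=1,\ X\succeq0\}$. For $A\in\mathbb{S}^n$, $\lambda_1(A)\ge\dots\ge\lambda_n(A)$ are its eigenvalues; for $X\in S_n$ set $\lambda_{n+1}(X):=0$. $[k]=\{1,\dots,k\}$. Standing assumptions. $f:\mathbb{S}^n\to\mathbb{R}$ is convex and $L$-smooth over $S_n$: $\|\nabla f(X)-\nabla f(Y)\|_F\le L\|X-Y\|_F$ for all $X,Y\in S_n$. $\mathcal X^*\subseteq S_n$ is the set of minimizers of $f$ over $S_n$ and $f^*$ the minimum value. Quadratic growth: there is $\mu>0$ with $\operatorname{dist}^2(X,\mathcal X^* )\le\frac2\mu(f(X)-f^*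 )$ for all $X\in S_n$ (Frobenius distance). Strict complementarity: there is an integer $r^*\in[n]$ such that $\operatorname{rank}(X^* )=r^*$ for all $X^*\in\mathcal X^*$; $\lambda_{r^*}:=\min_{X^*\in\mathcal X^*}\lambda_{r^*}(X^* )>0$; and if $r^*<n$ there is $\delta>0$ with $\lambda_{n-r^*}(\nabla f(X^* ))-\lambda_{n-r^*+1}(\nabla f(X^* ))=\delta$ for all $X^*\in\mathcal X^*$. Thresholding rank: $r_d(X):=\max\{i\in[n] : \lambda_i(X)>d\}$, with $\max\emptyset=0$. Thresholding mapping. For $X\in S_n$, $G\in\mathbb{S}^n$, $d\ge0$ and integer $0\le r\le n$, let $v_1,\dots,v_n$ be an orthonormal eigenbasis of $G$ with $Gv_i=\lambda_i(G)v_i$, $V=[v_n,\dots,v_{n-r+1}]$, and $$\mathcal H(X,G,d,r):=V(\Lambda_r-dI_r)V^T+n\widehat d\,v_nv_n^T,\quad \Lambda_r=\operatorname{diag}\{\lambda_1(X),\dots,\lambda_r(X)\},\quad \widehat d=\tfrac1n\Big(1+rd-\sum_{i=1}^r\lambda_i(X)\Big),$$ with $\mathcal H(X,G,d,0)=v_nv_n^T$. Algorithm ERSO-FW. Input: $X_0\in S_n$, a lower bound $B_0\le f^*$, step-sizes $\eta_t\in[0,1]$. Set $d_0=\sqrt{2(f(X_0)-B_0)/\mu}$ and $\widehat r_0=0$. For $t=1,2,\dots$: - Let $\overline r_{t-1}=\max\{\widehat r_0,\dots,\widehat r_{t-1}\}$. If $d_{t-1}\ge\lambda_{\overline r_{t-1}+1}(X_{t-1})$,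 set $\widehat r_t=\max\{i\in[\overline r_{t-1}] : \lambda_i(X_{t-1})>d_{t-1}\}$ (with $\max\emptyset=0$), which then equals $r_t$; otherwise set $\widehat r_t=\overline r_{t-1}+1$. - $\widehat Y_t=\mathcal H(X_{t-1},\nabla f(X_{t-1}),d_{t-1},\widehat r_t)$. - $B_t^w=f(X_{t-1})+\langle\nabla f(X_{t-1}),\widehat Y_t-X_{t-1}\rangle$ and $B_t=\max\{B_{t-1},B_t^w\}$. - $X_t=(1-\eta_t)X_{t-1}+\eta_t\widehat Y_t$. - $d_t=\sqrt{2(f(X_t)-B_t)/\mu}$.
   Formalization: Claim (ii) is stated for t ≥ max(2, T_0), since when T_0 ≤ 1 it can fail at t = 1, where r_1 depends only on the arbitrary inputs X_0 and B_0; also L > 0 is assumed, since for L = 0 claim (iii) can fail at t = r* = 1. *)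

theory Defs
  imports "HOL-Analysis.Analysis"
begin

text \<open>
  Matrices are elements of \<^typ>\<open>real^'n^'n\<close> with \<open>n = CARD('n)\<close>. On this type the library inner
  product is \<open>A \<bullet> B = tr (A\<^sup>T B)\<close> and \<^const>\<open>norm\<close> is the Frobenius norm; hence \<^const>\<open>dist\<close> and
  \<^const>\<open>infdist\<close> are Frobenius distances.
\<close>

definition sym_mats :: "(real^'n^'n) set" where
  "sym_mats = {A. transpose A = A}"

definition spectrahedron :: "(real^'n^'n) set" where
  "spectrahedron = {X \<in> sym_mats. trace X = 1 \<and> (\<forall>u. 0 \<le> u \<bullet> (X *v u))}"

text \<open>
  The eigenvalues in nonincreasing order, repeated according to their multiplicity as roots of the
  characteristic polynomial. The list exists (and is unique) whenever that polynomial splits over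
  the reals, so in particular for every symmetric matrix.
\<close>

definition eigvals :: "real^'n^'n \<Rightarrow> real list" where
  "eigvals A = (THE xs. length xs = CARD('n) \<and> sorted_wrt (\<ge>) xs \<and>
     (\<forall>x. det (mat x - A) = (\<Prod>y\<leftarrow>xs. x - y)))"

text \<open>
  Eigenvalues are numbered from 1 to \<open>n\<close>; the value at \<open>n + 1\<close> is 0 by convention (as it is at the
  other out-of-range indices).
\<close>

definition eigval :: "real^'n^'n \<Rightarrow> nat \<Rightarrow> real" where
  "eigval A i = (if 1 \<le> i \<and> i \<le> CARD('n) then eigvals A ! (i - 1) else 0)"

text \<open>
  \<open>g\<close> is the gradient at \<open>X\<close> of \<open>f\<close> regarded as a function on the Euclidean space of symmetric
  matrices: the derivative is taken within that space, and symmetry of \<open>g\<close> makes it unique. Values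
  of \<open>f\<close> at non-symmetric matrices play no role.
\<close>

definition is_sym_gradient ::
    "(real^'n^'n \<Rightarrow> real) \<Rightarrow> real^'n^'n \<Rightarrow> real^'n^'n \<Rightarrow> bool" where
  "is_sym_gradient f X g \<longleftrightarrow>
     g \<in> sym_mats \<and> (f has_derivative (\<lambda>H. g \<bullet> H)) (at X within sym_mats)"

definition L_smooth :: "(real^'n^'n \<Rightarrow> real^'n^'n) \<Rightarrow> real \<Rightarrow> bool" where
  "L_smooth grad L \<longleftrightarrow>
     (\<forall>X\<in>spectrahedron. \<forall>Y\<in>spectrahedron. norm (grad X - grad Y) \<le> L * norm (X - Y))"

definition minimizers :: "(real^'n^'n \<Rightarrow> real) \<Rightarrow> (real^'n^'n) set" where
  "minimizers f = {X. is_arg_min f (\<lambda>Y. Y \<in> spectrahedron) X}"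

text \<open>
  For \<open>f\<close> differentiable on the compact set \<^const>\<open>spectrahedron\<close> this infimum is attained, so it is
  the minimum value.
\<close>

definition min_value :: "(real^'n^'n \<Rightarrow> real) \<Rightarrow> real" where
  "min_value f = (INF X\<in>spectrahedron. f X)"

definition quadratic_growth :: "(real^'n^'n \<Rightarrow> real) \<Rightarrow> real \<Rightarrow> bool" where
  "quadratic_growth f \<mu> \<longleftrightarrow>
     (\<forall>X\<in>spectrahedron. (infdist X (minimizers f))\<^sup>2 \<le> 2 / \<mu> * (f X - min_value f))"

text \<open>The infimum is again attained: the set of minimizers is compact and \<^const>\<open>eigval\<close> is continuous
  on symmetric matrices.\<close>

definition min_eigval :: "(real^'n^'n \<Rightarrow> real) \<Rightarrow> nat \<Rightarrow> real" where
  "min_eigval f r = (INF X\<in>minimizers f. eigval X r)"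

definition strict_complementarity ::
    "(real^'n^'n \<Rightarrow> real) \<Rightarrow> (real^'n^'n \<Rightarrow> real^'n^'n) \<Rightarrow> nat \<Rightarrow> bool" where
  "strict_complementarity f grad r \<longleftrightarrow>
     1 \<le> r \<and> r \<le> CARD('n) \<and>
     (\<forall>X\<in>minimizers f. rank X = r) \<and>
     0 < min_eigval f r \<and>
     (r < CARD('n) \<longrightarrow> (\<exists>\<delta>>0. \<forall>X\<in>minimizers f.
        eigval (grad X) (CARD('n) - r) - eigval (grad X) (CARD('n) - r + 1) = \<delta>))"

definition thresh_rank :: "real \<Rightarrow> real^'n^'n \<Rightarrow> nat" where
  "thresh_rank d X = Max (insert 0 {i \<in> {1..CARD('n)}. d < eigval X i})"

text \<open>An orthonormal eigenbasis \<open>v 1, \<dots>, v n\<close> of \<open>G\<close>, ordered as the eigenvalues are; values of \<open>v\<close>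
  outside \<open>{1..n}\<close> are irrelevant.\<close>

definition eigenbasis :: "real^'n^'n \<Rightarrow> (nat \<Rightarrow> real^'n) \<Rightarrow> bool" where
  "eigenbasis G v \<longleftrightarrow>
     (\<forall>i\<in>{1..CARD('n)}. \<forall>j\<in>{1..CARD('n)}. v i \<bullet> v j = (if i = j then 1 else 0)) \<and>
     (\<forall>i\<in>{1..CARD('n)}. G *v v i = eigval G i *\<^sub>R v i)"

definition outer :: "real^'n \<Rightarrow> real^'n^'n" where
  "outer u = (\<chi> i j. u $ i * u $ j)"

text \<open>
  The thresholding mapping, as a function of an eigenbasis \<open>v\<close> of the second argument \<open>G\<close> of the
  mapping (on which it depends when \<open>G\<close> has repeated eigenvalues). With columns
  \<open>V = [v n, \<dots>, v (n - r + 1)]\<close>, the product \<open>V (\<Lambda>\<^sub>r - d I\<^sub>r) V\<^sup>T\<close> is written as a sum of rank-one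
  matrices, because \<open>r\<close> varies and so cannot be the column dimension of a matrix type.
\<close>

definition thresh_map :: "real^'n^'n \<Rightarrow> (nat \<Rightarrow> real^'n) \<Rightarrow> real \<Rightarrow> nat \<Rightarrow> real^'n^'n" where
  "thresh_map X v d r =
     (if r = 0 then outer (v CARD('n))
      else let dhat = (1 + real r * d - (\<Sum>i=1..r. eigval X i)) / real CARD('n)
           in (\<Sum>i=1..r. (eigval X i - d) *\<^sub>R outer (v (CARD('n) + 1 - i)))
              + (real CARD('n) * dhat) *\<^sub>R outer (v CARD('n)))"

text \<open>
  \<open>ERSO_FW f grad \<mu> \<eta> v X Y B d rhat\<close>: the sequences \<open>X\<close>, \<open>Y\<close>, \<open>B\<close>, \<open>d\<close>, \<open>rhat\<close> form a run of ERSO-FW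
  with step sizes \<open>\<eta>\<close>, where \<open>v t\<close> is the eigenbasis of the gradient used in iteration \<open>t\<close>. Any
  eigenbasis may be used in each iteration. The entries \<open>\<eta> 0\<close>, \<open>v 0\<close>, \<open>Y 0\<close> are irrelevant.
\<close>

definition ERSO_FW ::
    "(real^'n^'n \<Rightarrow> real) \<Rightarrow> (real^'n^'n \<Rightarrow> real^'n^'n) \<Rightarrow> real \<Rightarrow> (nat \<Rightarrow> real) \<Rightarrow>
     (nat \<Rightarrow> nat \<Rightarrow> real^'n) \<Rightarrow> (nat \<Rightarrow> real^'n^'n) \<Rightarrow> (nat \<Rightarrow> real^'n^'n) \<Rightarrow>
     (nat \<Rightarrow> real) \<Rightarrow> (nat \<Rightarrow> real) \<Rightarrow> (nat \<Rightarrow> nat) \<Rightarrow> bool" where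
  "ERSO_FW f grad \<mu> \<eta> v X Y B d rhat \<longleftrightarrow>
     X 0 \<in> spectrahedron \<and> B 0 \<le> min_value f \<and>
     d 0 = sqrt (2 * (f (X 0) - B 0) / \<mu>) \<and> rhat 0 = 0 \<and>
     (\<forall>t\<ge>1.
        \<eta> t \<in> {0..1} \<and>
        rhat t = (let rbar = Max (rhat ` {..t - 1})
                  in if eigval (X (t - 1)) (rbar + 1) \<le> d (t - 1)
                     then Max (insert 0 {i \<in> {1..rbar}. d (t - 1) < eigval (X (t - 1)) i})
                     else rbar + 1) \<and>
        eigenbasis (grad (X (t - 1))) (v t) \<and>
        Y t = thresh_map (X (t - 1)) (v t) (d (t - 1)) (rhat t) \<and>
        B t = max (B (t - 1)) (f (X (t - 1)) + grad (X (t - 1)) \<bullet> (Y t - X (t - 1))) \<and>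
        X t = (1 - \<eta> t) *\<^sub>R X (t - 1) + \<eta> t *\<^sub>R Y t \<and>
        d t = sqrt (2 * (f (X t) - B t) / \<mu>))"

definition open_loop_steps :: "(nat \<Rightarrow> real) \<Rightarrow> bool" where
  "open_loop_steps \<eta> \<longleftrightarrow> (\<forall>t\<ge>1. \<eta> t = 2 / (real t + 1))"

definition line_search_steps ::
    "(real^'n^'n \<Rightarrow> real) \<Rightarrow> (nat \<Rightarrow> real) \<Rightarrow> (nat \<Rightarrow> real^'n^'n) \<Rightarrow> (nat \<Rightarrow> real^'n^'n) \<Rightarrow> bool" where
  "line_search_steps f \<eta> X Y \<longleftrightarrow>
     (\<forall>t\<ge>1. is_arg_min (\<lambda>s. f ((1 - s) *\<^sub>R X (t - 1) + s *\<^sub>R Y t)) (\<lambda>s. s \<in> {0..1}) (\<eta> t))"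

end

theory Submission
  imports Defs
begin

text \<open>
  Quadratic growth makes the radius \<open>d\<close> an upper bound for the distance from the iterate \<open>X\<close> to some
  minimizer \<open>Z\<close>, as long as \<open>B\<close> is a lower bound for the minimum value. Weyl's inequality then gives
  two facts. First, eigenvalues of \<open>X\<close> beyond the rank of \<open>Z\<close> are at most \<open>d\<close>, so the thresholding
  rank is at most \<open>r\<^sup>*\<close>. Second, \<open>Z\<close> lies in the set of matrices whose leading eigenvalues dominate
  \<open>\<lambda>\<^sub>i(X) - d\<close>, over which the thresholding mapping minimizes the linearized objective (Ky Fan's
  inequality and summation by parts); hence the new \<open>B\<close> is again a lower bound.

  With \<open>\<eta> = 2 / (t + 1)\<close> the descent inequality and the bound 2 on the squared diameter of the
  spectrahedron give \<open>g\<^sub>t \<le> (1 - \<eta>) g\<^sub>t\<^sub>-\<^sub>1 + \<eta>\<^sup>2 L\<close> for the gap \<open>g\<^sub>t = f(X\<^sub>t) - B\<^sub>t\<close>, and line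
  search can only do better. So \<open>g\<^sub>t = O(L / t)\<close>, which for \<open>t \<ge> T\<^sub>0\<close> forces \<open>d \<le> \<lambda> / 3\<close>, where \<open>\<lambda>\<close>
  is the least \<open>r\<^sup>*\<close>-th eigenvalue of a minimizer; then
  \<open>\<lambda>\<^sub>r(X) \<ge> \<lambda> - d > d\<close> at \<open>r = r\<^sup>*\<close>. Finally the efficient rank is the minimum of the thresholding
  rank and one plus the largest earlier efficient rank, so it reaches \<open>r\<^sup>*\<close> after at most \<open>r\<^sup>*\<close>
  further iterations.
\<close>

section \<open>Spectral theorem\<close>

text \<open>The index set is explicit so that one notion covers both the partial families built
  during the spectral theorem and full eigenbases.\<close>

definition orthonormal_on :: "nat set \<Rightarrow> (nat \<Rightarrow> real^'n) \<Rightarrow> bool" where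
  "orthonormal_on I u \<longleftrightarrow> (\<forall>i\<in>I. \<forall>j\<in>I. u i \<bullet> u j = (if i = j then 1 else 0))"

lemma orthonormal_on_subset: "orthonormal_on I u \<Longrightarrow> J \<subseteq> I \<Longrightarrow> orthonormal_on J u"
  unfolding orthonormal_on_def by blast

lemma orthonormal_on_inj_on:
  assumes "orthonormal_on I u" shows "inj_on u I"
  using assms unfolding orthonormal_on_def inj_on_def by (metis zero_neq_one)

lemma orthonormal_on_independent:
  fixes u :: "nat \<Rightarrow> real^'n"
  assumes "orthonormal_on I u" shows "independent (u ` I)"
proof (rule pairwise_orthogonal_independent)
  show "pairwise orthogonal (u ` I)"
    using assms by (auto simp: pairwise_def orthogonal_def orthonormal_on_def split: if_splits)
  show "0 \<notin> u ` I"
    using assms by (force simp: orthonormal_on_def)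
qed

lemma orthonormal_on_dim_span:
  fixes u :: "nat \<Rightarrow> real^'n"
  assumes "orthonormal_on I u" shows "dim (span (u ` I)) = card I"
  by (simp add: dim_eq_card_independent[OF orthonormal_on_independent[OF assms]]
      card_image[OF orthonormal_on_inj_on[OF assms]])

text \<open>A family of \<open>CARD('n)\<close> orthonormal vectors spans the space. The difference
  between \<open>x\<close> and its expansion is orthogonal to each \<open>u j\<close>, hence to the
  whole span and so to itself.\<close>

lemma orthonormal_on_expand:
  fixes u :: "nat \<Rightarrow> real^'n"
  assumes "orthonormal_on {1..CARD('n)} u"
  shows "x = (\<Sum>i=1..CARD('n). (x \<bullet> u i) *\<^sub>R u i)"
proof -
  let ?y = "x - (\<Sum>i=1..CARD('n). (x \<bullet> u i) *\<^sub>R u i)"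
  have "orthogonal ?y a" if "a \<in> u ` {1..CARD('n)}" for a
  proof -
    from that obtain j where j: "j \<in> {1..CARD('n)}" "a = u j" by auto
    have "(\<Sum>i=1..CARD('n). (x \<bullet> u i) * (u i \<bullet> u j)) = (\<Sum>i=1..CARD('n). if i = j then x \<bullet> u j else 0)"
      using assms j by (intro sum.cong) (auto simp: orthonormal_on_def)
    then show ?thesis
      using j by (simp add: orthogonal_def inner_diff_left inner_sum_left)
  qed
  moreover have "span (u ` {1..CARD('n)}) = (UNIV :: (real^'n) set)"
    using orthonormal_on_dim_span[OF assms] dim_eq_full[of "span (u ` {1..CARD('n)})"]
    by (simp add: span_span)
  ultimately have "orthogonal ?y ?y"
    by (intro orthogonal_to_span[of ?y "u ` {1..CARD('n)}"]) simp_all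
  then show ?thesis by (simp add: orthogonal_def)
qed

lemma orthonormal_on_parseval:
  fixes u :: "nat \<Rightarrow> real^'n"
  assumes "orthonormal_on {1..CARD('n)} u"
  shows "x \<bullet> y = (\<Sum>i=1..CARD('n). (x \<bullet> u i) * (y \<bullet> u i))"
proof -
  have "x \<bullet> y = (\<Sum>i=1..CARD('n). (x \<bullet> u i) *\<^sub>R u i) \<bullet> y"
    using orthonormal_on_expand[OF assms, of x] by simp
  then show ?thesis by (simp add: inner_sum_left inner_sum_right inner_commute)
qed

text \<open>This is nonnegativity of the squared norm of \<open>x - ?p\<close>, where
  \<open>?p\<close> is the orthogonal projection of \<open>x\<close> onto the span.\<close>

lemma orthonormal_on_bessel:
  fixes u :: "nat \<Rightarrow> real^'n"
  assumes "orthonormal_on I u" "finite I"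
  shows "(\<Sum>i\<in>I. (x \<bullet> u i)\<^sup>2) \<le> x \<bullet> x"
proof -
  let ?p = "\<Sum>i\<in>I. (x \<bullet> u i) *\<^sub>R u i"
  have "(\<Sum>j\<in>I. (x \<bullet> u j) * (u j \<bullet> u i)) = (\<Sum>j\<in>I. if j = i then x \<bullet> u i else 0)" if "i \<in> I" for i
    using assms that by (intro sum.cong) (auto simp: orthonormal_on_def)
  then have "?p \<bullet> ?p = (\<Sum>i\<in>I. (x \<bullet> u i)\<^sup>2)"
    using assms(2)
    by (simp add: inner_sum_left inner_sum_right power2_eq_square )
  moreover have "x \<bullet> ?p = (\<Sum>i\<in>I. (x \<bullet> u i)\<^sup>2)"
    by (simp add: inner_sum_right power2_eq_square)
  moreover have "0 \<le> (x - ?p) \<bullet> (x - ?p)" by simp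
  ultimately show ?thesis
    by (simp add: inner_diff_left inner_diff_right inner_commute)
qed

lemma sym_mats_inner:
  assumes "A \<in> sym_mats" shows "x \<bullet> (A *v y) = (A *v x) \<bullet> y"
  using assms dot_lmul_matrix[of x A y]
  by (metis (mono_tags) mem_Collect_eq sym_mats_def transpose_matrix_vector)

text \<open>A maximizer \<open>w\<close> of the Rayleigh quotient over the orthogonal complement of
  the earlier eigenvectors is again an eigenvector. Its maximality stays in the conclusion because
  it orders the eigenvalues in the induction that follows.\<close>

lemma sym_eigenvector_ext:
  fixes A :: "real^'n^'n"
  assumes A: "A \<in> sym_mats" and k: "k < CARD('n)"
    and on: "orthonormal_on {1..k} v" and ev: "\<forall>i\<in>{1..k}. A *v v i = m i *\<^sub>R v i"
  shows "\<exists>w l. w \<bullet> w = 1 \<and> (\<forall>i\<in>{1..k}. v i \<bullet> w = 0) \<and> A *v w = l *\<^sub>R w \<and>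
    (\<forall>x. (\<forall>i\<in>{1..k}. v i \<bullet> x = 0) \<longrightarrow> x \<bullet> (A *v x) \<le> l * (x \<bullet> x))"
proof -
  define S where "S = {x. \<forall>i\<in>{1..k}. v i \<bullet> x = 0}"
  \<comment> \<open>The earlier eigenvectors span a proper subspace, so the maximum is taken over a
    nonempty set.\<close>
  have "dim (span (v ` {1..k})) < DIM(real^'n)"
    using orthonormal_on_dim_span[OF on] k by simp
  then obtain y where y: "y \<noteq> 0" "\<And>z. z \<in> span (v ` {1..k}) \<Longrightarrow> orthogonal y z"
    using orthogonal_to_subspace_exists[of "v ` {1..k}"] by (metis dim_span)
  have yS: "y /\<^sub>R norm y \<in> S \<inter> sphere 0 1"
    using y(1) y(2)[OF span_base] by (auto simp: S_def orthogonal_def inner_commute[of "v _" y])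
  have "closed S"
  proof -
    have "S = (\<Inter>i\<in>{1..k}. {x. v i \<bullet> x = 0})" by (auto simp: S_def)
    then show ?thesis by (simp add: closed_INT closed_hyperplane)
  qed
  then have "compact (S \<inter> sphere 0 1)" by (simp add: closed_Int_compact)
  moreover have "continuous_on (S \<inter> sphere 0 1) (\<lambda>x. x \<bullet> (A *v x))"
    by (intro continuous_intros linear_continuous_on)
       (simp add: linear_linear matrix_vector_mul_linear)
  ultimately obtain w where w: "w \<in> S \<inter> sphere 0 1"
    and wmax: "\<And>x. x \<in> S \<inter> sphere 0 1 \<Longrightarrow> x \<bullet> (A *v x) \<le> w \<bullet> (A *v w)"
    using continuous_attains_sup[of "S \<inter> sphere 0 1" "\<lambda>x. x \<bullet> (A *v x)"] yS by blast
  define l where "l = w \<bullet> (A *v w)"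
  have ww: "w \<bullet> w = 1" using w by (simp add: norm_eq_1)
  have bound: "x \<bullet> (A *v x) \<le> l * (x \<bullet> x)" if "x \<in> S" for x
  proof (cases "x = 0")
    case False
    have "x /\<^sub>R norm x \<in> S \<inter> sphere 0 1" using that False by (auto simp: S_def)
    from wmax[OF this] have "(x \<bullet> (A *v x)) / (norm x)\<^sup>2 \<le> l"
      by (simp add: l_def matrix_vector_mult_scaleR power2_eq_square field_simps)
    then show ?thesis using False by (simp add: field_simps power2_norm_eq_inner)
  qed simp
  \<comment> \<open>First-order optimality: comparing \<open>w\<close> with
    \<open>w + s *\<^sub>R z\<close> gives an inequality in \<open>s\<close> whose linear term must
    vanish. Taking \<open>s\<close> as 1 and -1 yields \<open>c > 0\<close>, and then
    \<open>s = b / c\<close> contradicts \<open>b \<noteq> 0\<close>.\<close>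
  have crit: "z \<bullet> (A *v w) = 0" if z: "z \<in> S" "z \<bullet> w = 0" for z
  proof (rule ccontr)
    assume nz: "z \<bullet> (A *v w) \<noteq> 0"
    define b where "b = z \<bullet> (A *v w)"
    define c where "c = l * (z \<bullet> z) - z \<bullet> (A *v z)"
    have q: "2 * s * b \<le> s\<^sup>2 * c" for s
    proof -
      have "w + s *\<^sub>R z \<in> S" using z w by (auto simp: S_def inner_add_right)
      from bound[OF this] have "(w + s *\<^sub>R z) \<bullet> (A *v (w + s *\<^sub>R z)) \<le> l * ((w + s *\<^sub>R z) \<bullet> (w + s *\<^sub>R z))" .
      moreover have "w \<bullet> (A *v z) = b"
        using sym_mats_inner[OF A, of w z] by (simp add: b_def inner_commute)
      then have "(w + s *\<^sub>R z) \<bullet> (A *v (w + s *\<^sub>R z)) = l + 2 * s * b + s\<^sup>2 * (z \<bullet> (A *v z))"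
        by (simp add: matrix_vector_right_distrib matrix_vector_mult_scaleR inner_add_left
            inner_add_right b_def[symmetric] l_def[symmetric] power2_eq_square algebra_simps)
      moreover have "(w + s *\<^sub>R z) \<bullet> (w + s *\<^sub>R z) = 1 + s\<^sup>2 * (z \<bullet> z)"
        using ww z(2) by (simp add: inner_add_left inner_add_right power2_eq_square inner_commute[of w z])
      ultimately have "l + 2 * s * b + s\<^sup>2 * (z \<bullet> (A *v z)) \<le> l * (1 + s\<^sup>2 * (z \<bullet> z))"
        by simp
      then show ?thesis
        by (simp add: c_def algebra_simps)
    qed
    have "2 * b \<le> c" "- 2 * b \<le> c" using q[of 1] q[of "-1"] by simp_all
    then have "c > 0" using nz b_def by linarith
    have "2 * (b / c) * b \<le> (b / c)\<^sup>2 * c" by (rule q)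
    then have "2 * b\<^sup>2 \<le> b\<^sup>2" using \<open>c > 0\<close> by (simp add: field_simps power2_eq_square)
    then show False using nz b_def by simp
  qed
  \<comment> \<open>As \<open>A\<close> is symmetric and the \<open>v i\<close> are eigenvectors,
    \<open>S\<close> is invariant under \<open>A\<close>. So the residual \<open>y\<close> is an
    admissible direction orthogonal to \<open>w\<close>, and \<open>crit\<close> forces it to
    vanish.\<close>
  define y where "y = A *v w - l *\<^sub>R w"
  have yS: "y \<in> S"
    unfolding S_def
  proof (intro CollectI ballI)
    fix i assume i: "i \<in> {1..k}"
    have "v i \<bullet> (A *v w) = m i * (v i \<bullet> w)"
      using sym_mats_inner[OF A, of "v i" w] bspec[OF ev i] by simp
    then show "v i \<bullet> y = 0"
      using w i by (simp add: y_def S_def inner_diff_right)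
  qed
  have yw: "y \<bullet> w = 0" using ww by (simp add: y_def inner_diff_left l_def inner_commute[of "A *v w"])
  have "y \<bullet> (A *v w) = 0" by (rule crit[OF yS yw])
  moreover have "A *v w = y + l *\<^sub>R w" by (simp add: y_def)
  ultimately have "y \<bullet> y = 0" using yw by (simp add: inner_add_right)
  then have "A *v w = l *\<^sub>R w" by (simp add: y_def)
  moreover have "\<forall>i\<in>{1..k}. v i \<bullet> w = 0" using w by (simp add: S_def)
  moreover have "\<forall>x. (\<forall>i\<in>{1..k}. v i \<bullet> x = 0) \<longrightarrow> x \<bullet> (A *v x) \<le> l * (x \<bullet> x)"
    using bound by (simp add: S_def)
  ultimately show ?thesis using ww by (intro exI[of _ w] exI[of _ l] conjI)
qed

text \<open>Eigenvectors are split off one at a time, largest eigenvalue first. The last conjunct is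
  the invariant behind the ordering: the next eigenvector lies in the orthogonal complement, so its
  eigenvalue is at most \<open>m k\<close>. The guard \<open>1 \<le> k\<close> excludes the start,
  where \<open>m 0\<close> bounds nothing.\<close>

lemma sym_spectral_partial:
  fixes A :: "real^'n^'n"
  assumes A: "A \<in> sym_mats" and "k \<le> CARD('n)"
  shows "\<exists>v m. orthonormal_on {1..k} v \<and> (\<forall>i\<in>{1..k}. A *v v i = m i *\<^sub>R v i) \<and>
    (\<forall>i j. 1 \<le> i \<and> i \<le> j \<and> j \<le> k \<longrightarrow> m j \<le> m i) \<and>
    (\<forall>x. 1 \<le> k \<and> (\<forall>i\<in>{1..k}. v i \<bullet> x = 0) \<longrightarrow> x \<bullet> (A *v x) \<le> m k * (x \<bullet> x))"
  using assms(2)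
proof (induction k)
  case 0
  then show ?case by (simp add: orthonormal_on_def)
next
  case (Suc k)
  from Suc.IH[OF Suc_leD[OF Suc.prems]] obtain v m where vm: "orthonormal_on {1..k} v"
      "\<forall>i\<in>{1..k}. A *v v i = m i *\<^sub>R v i"
      "\<forall>i j. 1 \<le> i \<and> i \<le> j \<and> j \<le> k \<longrightarrow> m j \<le> m i"
      "\<forall>x. 1 \<le> k \<and> (\<forall>i\<in>{1..k}. v i \<bullet> x = 0) \<longrightarrow> x \<bullet> (A *v x) \<le> m k * (x \<bullet> x)"
    by (elim exE conjE) (rule that)
  note on = vm(1) and ev = vm(2)
  have anti: "\<And>i j. \<lbrakk>1 \<le> i; i \<le> j; j \<le> k\<rbrakk> \<Longrightarrow> m j \<le> m i" using vm(3) by blast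
  have kn: "k < CARD('n)" using Suc.prems by simp
  obtain w l where w: "w \<bullet> w = 1" "\<forall>i\<in>{1..k}. v i \<bullet> w = 0" "A *v w = l *\<^sub>R w"
    and l: "\<forall>x. (\<forall>i\<in>{1..k}. v i \<bullet> x = 0) \<longrightarrow> x \<bullet> (A *v x) \<le> l * (x \<bullet> x)"
    using sym_eigenvector_ext[OF A kn on ev] by (elim exE conjE) (rule that)
  have lk: "l \<le> m k" if "1 \<le> k" using vm(4)[rule_format, of w] that w by simp
  have lm: "l \<le> m i" if "1 \<le> i" "i \<le> k" for i
    using lk anti[of i k] that by linarith
  let ?v = "v(Suc k := w)" and ?m = "m(Suc k := l)"
  have E: "{1..Suc k} = insert (Suc k) {1..k}" by auto
  have n1: "orthonormal_on {1..Suc k} ?v"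
    unfolding orthonormal_on_def E
  proof (intro ballI)
    fix i j assume "i \<in> insert (Suc k) {1..k}" "j \<in> insert (Suc k) {1..k}"
    then consider "i = Suc k" "j = Suc k" | "i = Suc k" "j \<in> {1..k}" | "i \<in> {1..k}" "j = Suc k"
      | "i \<in> {1..k}" "j \<in> {1..k}" by blast
    then show "?v i \<bullet> ?v j = (if i = j then 1 else 0)"
    proof cases
      case 1
      then show ?thesis using w(1) by simp
    next
      case 2
      then have "v j \<bullet> w = 0" "j \<noteq> Suc k" using w(2) by auto
      then show ?thesis using 2 by (simp add: inner_commute[of w "v j"])
    next
      case 3
      then have "v i \<bullet> w = 0" "i \<noteq> Suc k" using w(2) by auto
      then show ?thesis using 3 by simp
    next
      case 4
      then have "i \<noteq> Suc k" "j \<noteq> Suc k" by auto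
      then show ?thesis using 4 on by (simp add: orthonormal_on_def)
    qed
  qed
  have n2: "\<forall>i\<in>{1..Suc k}. A *v ?v i = ?m i *\<^sub>R ?v i"
  proof
    fix i assume "i \<in> {1..Suc k}"
    then consider "i = Suc k" | "i \<in> {1..k}" "i \<noteq> Suc k" by fastforce
    then show "A *v ?v i = ?m i *\<^sub>R ?v i"
      by cases (use ev w(3) in auto)
  qed
  have n3: "\<forall>i j. 1 \<le> i \<and> i \<le> j \<and> j \<le> Suc k \<longrightarrow> ?m j \<le> ?m i"
  proof (intro allI impI, elim conjE)
    fix i j assume "1 \<le> i" "i \<le> j" "j \<le> Suc k"
    then show "?m j \<le> ?m i"
      using anti[of i j] lm[of i] by (cases "j = Suc k"; cases "i = Suc k") auto
  qed
  have n4: "\<forall>x. 1 \<le> Suc k \<and> (\<forall>i\<in>{1..Suc k}. ?v i \<bullet> x = 0) \<longrightarrow> x \<bullet> (A *v x) \<le> ?m (Suc k) * (x \<bullet> x)"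
  proof (intro allI impI, elim conjE)
    fix x assume x: "\<forall>i\<in>{1..Suc k}. ?v i \<bullet> x = 0"
    have "v i \<bullet> x = 0" if "i \<in> {1..k}" for i
      using bspec[OF x, of i] that by (simp split: if_splits)
    then show "x \<bullet> (A *v x) \<le> ?m (Suc k) * (x \<bullet> x)" using l by simp
  qed
  show ?case by (rule exI[of _ ?v], rule exI[of _ ?m], rule conjI[OF n1 conjI[OF n2 conjI[OF n3 n4]]])
qed

section \<open>Ordered eigenvalues\<close>

text \<open>With the eigenvectors as columns of an invertible matrix \<open>P\<close>, one has
  \<open>(mat x - A) ** P = P ** D\<close> for a diagonal \<open>D\<close>; in the determinants
  \<open>det P\<close> cancels.\<close>

lemma orthonormal_on_det:
  fixes A :: "real^'n^'n"
  assumes on: "orthonormal_on {1..CARD('n)} v"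
    and ev: "\<And>i. i \<in> {1..CARD('n)} \<Longrightarrow> A *v v i = m i *\<^sub>R v i"
  shows "det (mat x - A) = (\<Prod>i=1..CARD('n). x - m i)"
proof -
  \<comment> \<open>Matrix columns are indexed by the type \<open>'n\<close> and eigenvectors by
    numbers; \<open>g\<close> translates between the two.\<close>
  obtain g :: "'n \<Rightarrow> nat" where g: "bij_betw g UNIV {1..CARD('n)}"
    using finite_same_card_bij[of "UNIV :: 'n set" "{1..CARD('n)}"] by auto
  have gi: "g j \<in> {1..CARD('n)}" for j using g by (auto simp: bij_betw_def)
  have ginj: "g i = g j \<longleftrightarrow> i = j" for i j using g by (auto simp: bij_betw_def inj_on_def)
  define P :: "real^'n^'n" where "P = (\<chi> i j. v (g j) $ i)"
  define D :: "real^'n^'n" where "D = (\<chi> i j. if i = j then x - m (g j) else 0)"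
  have "transpose P ** P = mat 1"
  proof -
    have "(transpose P ** P) $ i $ j = v (g i) \<bullet> v (g j)" for i j
      by (simp add: matrix_matrix_mult_def transpose_def P_def inner_vec_def)
    then show ?thesis
      using on gi by (simp add: vec_eq_iff orthonormal_on_def mat_def ginj)
  qed
  then have "det (transpose P) * det P = 1"
    using det_mul[of "transpose P" P] by simp
  then have "det P \<noteq> 0" by auto
  moreover have "(mat x - A) ** P = P ** D"
  proof -
    have "((mat x - A) ** P) $ i $ j = ((mat x - A) *v v (g j)) $ i" for i j
      by (simp add: matrix_matrix_mult_def matrix_vector_mult_def P_def)
    moreover have "(mat x - A) *v v (g j) = (x - m (g j)) *\<^sub>R v (g j)" for j
    proof -
      have "mat x *v v (g j) = x *\<^sub>R v (g j)"
        by (simp add: vec_eq_iff matrix_vector_mult_def mat_def if_distrib if_distribR cong: if_cong)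
      then show ?thesis
        by (simp add: matrix_vector_mult_diff_rdistrib ev[OF gi] scaleR_diff_left)
    qed
    moreover have "(P ** D) $ i $ j = (x - m (g j)) * v (g j) $ i" for i j
      by (simp add: matrix_matrix_mult_def P_def D_def if_distrib cong: if_cong)
    ultimately show ?thesis by (simp add: vec_eq_iff)
  qed
  then have "det (mat x - A) * det P = det P * det D" by (metis det_mul)
  ultimately have "det (mat x - A) = det D" by simp
  also have "\<dots> = (\<Prod>j\<in>UNIV. x - m (g j))"
    by (subst det_diagonal) (simp_all add: D_def)
  also have "\<dots> = (\<Prod>i=1..CARD('n). x - m i)"
    using prod.reindex_bij_betw[OF g, of "\<lambda>i. x - m i"] by simp
  finally show ?thesis .
qed

text \<open>Both heads are the largest root of the same polynomial, so they agree; cancelling that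
  linear factor leaves the tails.\<close>

lemma sorted_roots_unique:
  fixes xs ys :: "real list"
  assumes "sorted_wrt (\<ge>) xs" "sorted_wrt (\<ge>) ys" "length xs = length ys"
    and "\<And>x. (\<Prod>y\<leftarrow>xs. x - y) = (\<Prod>y\<leftarrow>ys. x - y)"
  shows "xs = ys"
proof -
  \<comment> \<open>Values at a single point cannot be divided by the factor that vanishes there; in
    the ring of polynomials the cancellation is valid.\<close>
  have "(\<Prod>y\<leftarrow>xs. [:- y, 1:]) = (\<Prod>y\<leftarrow>ys. [:- y, 1:])"
  proof -
    have "poly (\<Prod>y\<leftarrow>zs. [:- y, 1:]) x = (\<Prod>y\<leftarrow>zs. x - y)" for x :: real and zs
      by (induction zs) (simp_all add: left_diff_distrib)
    then show ?thesis using assms(4) by (simp add: poly_eq_poly_eq_iff[symmetric] fun_eq_iff)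
  qed
  with assms(1-3) show ?thesis
  proof (induction xs arbitrary: ys)
    case (Cons a xs)
    then obtain b ys' where ys: "ys = b # ys'" by (cases ys) auto
    have mem: "poly (\<Prod>y\<leftarrow>zs. [:- y, 1:]) x = 0 \<longleftrightarrow> x \<in> set zs" for x :: real and zs
      by (induction zs) auto
    have "a \<in> set ys" using mem[of ys a] mem[of "a # xs" a] unfolding Cons.prems(4) by simp
    moreover have "b \<in> set (a # xs)" using mem[of ys b] mem[of "a # xs" b] ys unfolding Cons.prems(4) by simp
    ultimately have "a = b" using Cons.prems(1,2) ys by force
    then have "[:- a, 1:] * (\<Prod>y\<leftarrow>xs. [:- y, 1:]) = [:- a, 1:] * (\<Prod>y\<leftarrow>ys'. [:- y, 1:])"
      using Cons.prems(4) ys by (simp del: mult_pCons_left)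
    then have "(\<Prod>y\<leftarrow>xs. [:- y, 1:]) = (\<Prod>y\<leftarrow>ys'. [:- y, 1:])"
      by (subst (asm) mult_left_cancel) simp_all
    then show ?case using Cons.IH[of ys'] Cons.prems ys \<open>a = b\<close> by simp
  qed simp
qed

text \<open>The bridge from the characteristic polynomial in \<open>eigvals\<close> to eigenvectors;
  from the spectral theorem onwards only eigenbases are used.\<close>

lemma eigval_eqI:
  fixes A :: "real^'n^'n"
  assumes on: "orthonormal_on {1..CARD('n)} v"
    and ev: "\<And>i. i \<in> {1..CARD('n)} \<Longrightarrow> A *v v i = m i *\<^sub>R v i"
    and anti: "\<And>i j. \<lbrakk>1 \<le> i; i \<le> j; j \<le> CARD('n)\<rbrakk> \<Longrightarrow> m j \<le> m i"
    and i: "i \<in> {1..CARD('n)}"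
  shows "eigval A i = m i"
proof -
  let ?xs = "map m [1..<Suc CARD('n)]"
  have det: "det (mat x - A) = (\<Prod>y\<leftarrow>?xs. x - y)" for x
    using orthonormal_on_det[OF on ev, of x] prod.distinct_set_conv_list[of "[1..<Suc CARD('n)]" "\<lambda>i. x - m i"]
    by (simp add: atLeastLessThanSuc_atLeastAtMost comp_def del: upt_Suc)
  have srt: "sorted_wrt (\<ge>) ?xs"
    using anti by (simp add: sorted_wrt_iff_nth_less del: upt_Suc)
  have "eigvals A = ?xs"
    unfolding eigvals_def
  proof (rule the_equality)
    show "length ?xs = CARD('n) \<and> sorted_wrt (\<ge>) ?xs \<and> (\<forall>x. det (mat x - A) = (\<Prod>y\<leftarrow>?xs. x - y))"
      using det srt by simp
    fix ys assume ys: "length ys = CARD('n) \<and> sorted_wrt (\<ge>) ys \<and> (\<forall>x. det (mat x - A) = (\<Prod>y\<leftarrow>ys. x - y))"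
    show "ys = ?xs"
    proof (rule sorted_roots_unique[OF _ srt])
      show "(\<Prod>y\<leftarrow>ys. x - y) = (\<Prod>y\<leftarrow>?xs. x - y)" for x
        using ys det[of x] by simp
    qed (use ys in auto)
  qed
  then show ?thesis using i by (cases i) (simp_all add: eigval_def del: upt_Suc)
qed

lemma sym_mats_spectral:
  fixes A :: "real^'n^'n"
  assumes "A \<in> sym_mats"
  shows "\<exists>v. eigenbasis A v" and "\<lbrakk>1 \<le> i; i \<le> j; j \<le> CARD('n)\<rbrakk> \<Longrightarrow> eigval A j \<le> eigval A i"
proof -
  obtain v m where vm: "orthonormal_on {1..CARD('n)} v"
      "\<forall>i\<in>{1..CARD('n)}. A *v v i = m i *\<^sub>R v i"
      "\<forall>i j. 1 \<le> i \<and> i \<le> j \<and> j \<le> CARD('n) \<longrightarrow> m j \<le> m i"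
    using sym_spectral_partial[OF assms order.refl] by (elim exE conjE) (rule that)
  have e: "eigval A i = m i" if "i \<in> {1..CARD('n)}" for i
    using eigval_eqI[OF vm(1) _ _ that, of A m] vm(2,3) by simp
  show "\<exists>v. eigenbasis A v"
    using vm(1,2) e by (intro exI[of _ v]) (simp add: eigenbasis_def orthonormal_on_def)
  show "eigval A j \<le> eigval A i" if "1 \<le> i" "i \<le> j" "j \<le> CARD('n)"
    using vm(3) e that by simp
qed

lemma eigenbasisD:
  fixes A :: "real^'n^'n"
  assumes "eigenbasis A v"
  shows "orthonormal_on {1..CARD('n)} v"
    and "i \<in> {1..CARD('n)} \<Longrightarrow> A *v v i = eigval A i *\<^sub>R v i"
  using assms by (auto simp: eigenbasis_def orthonormal_on_def)

lemma outer_mult_vec: "outer u *v x = (u \<bullet> x) *\<^sub>R u"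
  by (simp add: vec_eq_iff matrix_vector_mult_def outer_def inner_vec_def sum_distrib_left
      sum_distrib_right mult_ac)

text \<open>Quadratic forms become linear functionals of the matrix, so Frobenius inner products and
  the Cauchy-Schwarz inequality apply to them.\<close>

lemma inner_outer: "M \<bullet> outer u = u \<bullet> (M *v u)"
  by (simp add: inner_vec_def outer_def matrix_vector_mult_def sum_distrib_left mult_ac)

lemma trace_eq_inner: "trace M = M \<bullet> mat 1" for M :: "real^'n^'n"
  by (simp add: trace_def inner_vec_def mat_def if_distrib cong: if_cong)

lemma eigenbasis_decomp:
  fixes A :: "real^'n^'n"
  assumes "eigenbasis A v"
  shows "A = (\<Sum>i=1..CARD('n). eigval A i *\<^sub>R outer (v i))"
proof -
  note v = eigenbasisD[OF assms]
  have "A *v x = (\<Sum>i=1..CARD('n). eigval A i *\<^sub>R outer (v i)) *v x" for x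
  proof -
    have "A *v x = A *v (\<Sum>i=1..CARD('n). (x \<bullet> v i) *\<^sub>R v i)"
      using orthonormal_on_expand[OF v(1), of x] by simp
    also have "\<dots> = (\<Sum>i=1..CARD('n). (x \<bullet> v i) *\<^sub>R (A *v v i))"
      by (simp add: linear_sum[OF matrix_vector_mul_linear] matrix_vector_mult_scaleR)
    also have "\<dots> = (\<Sum>i=1..CARD('n). (eigval A i *\<^sub>R outer (v i)) *v x)"
      using v(2) by (intro sum.cong)
        (simp_all add: scaleR_matrix_vector_assoc[symmetric] outer_mult_vec inner_commute)
    also have "\<dots> = (\<Sum>i=1..CARD('n). eigval A i *\<^sub>R outer (v i)) *v x"
      by (induction rule: infinite_finite_induct) (simp_all add: matrix_vector_mult_add_rdistrib)
    finally show ?thesis .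
  qed
  then show ?thesis by (simp add: matrix_eq)
qed

lemma eigenbasis_inner:
  fixes A :: "real^'n^'n"
  assumes "eigenbasis A v"
  shows "M \<bullet> A = (\<Sum>i=1..CARD('n). eigval A i * (v i \<bullet> (M *v v i)))"
  by (subst eigenbasis_decomp[OF assms]) (simp add: inner_sum_right inner_outer)

lemma eigenbasis_quad:
  fixes A :: "real^'n^'n"
  assumes "eigenbasis A v"
  shows "x \<bullet> (A *v x) = (\<Sum>i=1..CARD('n). eigval A i * (x \<bullet> v i)\<^sup>2)"
proof -
  have "x \<bullet> (A *v x) = outer x \<bullet> A" by (simp add: inner_outer inner_commute[of "outer x"])
  also have "\<dots> = (\<Sum>i=1..CARD('n). eigval A i * (v i \<bullet> (outer x *v v i)))"
    by (rule eigenbasis_inner[OF assms])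
  also have "\<dots> = (\<Sum>i=1..CARD('n). eigval A i * (x \<bullet> v i)\<^sup>2)"
    by (simp add: outer_mult_vec power2_eq_square inner_commute[of "v _" x])
  finally show ?thesis .
qed

lemma eigenbasis_trace:
  fixes A :: "real^'n^'n"
  assumes "eigenbasis A v"
  shows "trace A = (\<Sum>i=1..CARD('n). eigval A i)"
proof -
  have "trace A = (\<Sum>i=1..CARD('n). eigval A i * (v i \<bullet> v i))"
    using eigenbasis_inner[OF assms, of "mat 1"] by (simp add: trace_eq_inner inner_commute)
  also have "\<dots> = (\<Sum>i=1..CARD('n). eigval A i)"
    using eigenbasisD(1)[OF assms] by (intro sum.cong) (auto simp: orthonormal_on_def)
  finally show ?thesis .
qed

section \<open>Weyl's perturbation inequality\<close>

lemma norm_outer: "norm (outer u) = (norm u)\<^sup>2"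
proof -
  have "outer u \<bullet> outer u = (u \<bullet> u)\<^sup>2"
    by (simp add: inner_outer outer_mult_vec power2_eq_square)
  then show ?thesis by (simp add: norm_eq_sqrt_inner)
qed

lemma orthonormal_on_span_inner_eq_0:
  fixes u :: "nat \<Rightarrow> real^'n"
  assumes "orthonormal_on I u" "J \<subseteq> I" "x \<in> span (u ` J)" "j \<in> I - J"
  shows "x \<bullet> u j = 0"
proof -
  have "orthogonal (u j) x"
    using assms(3)
  proof (rule orthogonal_to_span)
    fix y assume "y \<in> u ` J"
    then obtain i where "i \<in> J" "y = u i" by auto
    then show "orthogonal (u j) y"
      using assms(1,2,4) by (auto simp: orthonormal_on_def orthogonal_def)
  qed
  then show ?thesis by (simp add: orthogonal_def inner_commute)
qed

text \<open>The span of the \<open>i\<close> leading eigenvectors of \<open>X\<close> and that of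
  the eigenvectors of \<open>Z\<close> from index \<open>i\<close> on have dimensions adding up to
  \<open>CARD('n) + 1\<close>, so they share some \<open>x \<noteq> 0\<close>. On it the form of
  \<open>X\<close> is at least \<open>eigval X i\<close> and that of \<open>Z\<close> at most
  \<open>eigval Z i\<close>, relative to \<open>x \<bullet> x\<close>; Cauchy-Schwarz against
  \<open>outer x\<close> bounds the difference of the forms.\<close>

lemma weyl_perturbation:
  fixes X Z :: "real^'n^'n"
  assumes X: "X \<in> sym_mats" and Z: "Z \<in> sym_mats" and i: "i \<in> {1..CARD('n)}"
  shows "eigval X i \<le> eigval Z i + norm (X - Z)"
proof -
  let ?N = "{1..CARD('n)}"
  obtain u w where uw: "eigenbasis X u" "eigenbasis Z w"
    using sym_mats_spectral(1)[OF X] sym_mats_spectral(1)[OF Z] by blast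
  note u = eigenbasisD(1)[OF uw(1)] and w = eigenbasisD(1)[OF uw(2)]
  define S where "S = span (u ` {1..i})"
  define T where "T = span (w ` {i..CARD('n)})"
  have dS: "dim S = i"
    using orthonormal_on_dim_span[OF orthonormal_on_subset[OF u, of "{1..i}"]] i by (simp add: S_def)
  have dT: "dim T = Suc (CARD('n) - i)"
    using orthonormal_on_dim_span[OF orthonormal_on_subset[OF w, of "{i..CARD('n)}"]] i
    by (simp add: T_def Suc_diff_le)
  have "dim {x + y |x y. x \<in> S \<and> y \<in> T} + dim (S \<inter> T) = dim S + dim T"
    by (rule dim_sums_Int) (simp_all add: S_def T_def)
  moreover have "dim {x + y |x y. x \<in> S \<and> y \<in> T} \<le> CARD('n)"
    using dim_subset_UNIV[of "{x + y |x y. x \<in> S \<and> y \<in> T}"] by simp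
  moreover have "i \<le> CARD('n)" using i by simp
  ultimately have "dim (S \<inter> T) \<noteq> 0" using dS dT by linarith
  then have "\<not> S \<inter> T \<subseteq> {0}" unfolding dim_eq_0 .
  then obtain x where x: "x \<in> S" "x \<in> T" "x \<noteq> 0" by blast
  have xu: "x \<bullet> u j = 0" if "j \<in> ?N" "i < j" for j
    using orthonormal_on_span_inner_eq_0[OF u, of "{1..i}" x j] x(1) i that by (auto simp: S_def)
  have xw: "x \<bullet> w j = 0" if "j \<in> ?N" "j < i" for j
    using orthonormal_on_span_inner_eq_0[OF w, of "{i..CARD('n)}" x j] x(2) i that by (auto simp: T_def)
  have "eigval X i * (x \<bullet> x) = (\<Sum>j\<in>?N. eigval X i * (x \<bullet> u j)\<^sup>2)"
    by (subst orthonormal_on_parseval[OF u]) (simp add: power2_eq_square sum_distrib_left)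
  also have "\<dots> \<le> (\<Sum>j\<in>?N. eigval X j * (x \<bullet> u j)\<^sup>2)"
  proof (rule sum_mono)
    fix j assume j: "j \<in> ?N"
    show "eigval X i * (x \<bullet> u j)\<^sup>2 \<le> eigval X j * (x \<bullet> u j)\<^sup>2"
    proof (cases "j \<le> i")
      case True
      then show ?thesis using sym_mats_spectral(2)[OF X, of j i] i j by (simp add: mult_right_mono)
    qed (use xu j in simp)
  qed
  also have "\<dots> = x \<bullet> (X *v x)" by (rule eigenbasis_quad[OF uw(1), symmetric])
  finally have 1: "eigval X i * (x \<bullet> x) \<le> x \<bullet> (X *v x)" .
  have "x \<bullet> (Z *v x) = (\<Sum>j\<in>?N. eigval Z j * (x \<bullet> w j)\<^sup>2)" by (rule eigenbasis_quad[OF uw(2)])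
  also have "\<dots> \<le> (\<Sum>j\<in>?N. eigval Z i * (x \<bullet> w j)\<^sup>2)"
  proof (rule sum_mono)
    fix j assume j: "j \<in> ?N"
    show "eigval Z j * (x \<bullet> w j)\<^sup>2 \<le> eigval Z i * (x \<bullet> w j)\<^sup>2"
    proof (cases "i \<le> j")
      case True
      then show ?thesis using sym_mats_spectral(2)[OF Z, of i j] i j by (simp add: mult_right_mono)
    qed (use xw j in simp)
  qed
  also have "\<dots> = eigval Z i * (x \<bullet> x)"
    by (subst orthonormal_on_parseval[OF w, of x x]) (simp add: power2_eq_square sum_distrib_left)
  finally have 2: "x \<bullet> (Z *v x) \<le> eigval Z i * (x \<bullet> x)" .
  have "x \<bullet> (X *v x) - x \<bullet> (Z *v x) = (X - Z) \<bullet> outer x"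
    by (simp add: inner_outer matrix_vector_mult_diff_rdistrib inner_diff_right)
  also have "\<dots> \<le> norm (X - Z) * (x \<bullet> x)"
    using norm_cauchy_schwarz[of "X - Z" "outer x"] by (simp add: norm_outer power2_norm_eq_inner)
  finally have "eigval X i * (x \<bullet> x) \<le> (eigval Z i + norm (X - Z)) * (x \<bullet> x)"
    using 1 2 by (simp add: algebra_simps)
  then show ?thesis using x(3) by (simp add: mult_le_cancel_right)
qed

section \<open>The spectrahedron and the thresholding mapping\<close>

text \<open>Summation by parts in inductive form: the partial sum is nonnegative, so its factor
  \<open>a (Suc r)\<close> may be raised to \<open>a r\<close> before the induction hypothesis
  applies.\<close>

lemma sum_mult_antimono_ge:
  fixes a c :: "nat \<Rightarrow> real"
  assumes "\<And>i j. \<lbrakk>1 \<le> i; i \<le> j; j \<le> r\<rbrakk> \<Longrightarrow> a j \<le> a i"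
    and "\<And>k. k \<le> r \<Longrightarrow> 0 \<le> (\<Sum>i=1..k. c i)" and "1 \<le> r"
  shows "a r * (\<Sum>i=1..r. c i) \<le> (\<Sum>i=1..r. a i * c i)"
  using assms
proof (induction r)
  case (Suc r)
  show ?case
  proof (cases "r = 0")
    case False
    have "a (Suc r) * (\<Sum>i=1..r. c i) \<le> a r * (\<Sum>i=1..r. c i)"
      using Suc.prems(1)[of r "Suc r"] Suc.prems(2)[of r] False by (simp add: mult_right_mono)
    also have "\<dots> \<le> (\<Sum>i=1..r. a i * c i)"
      using Suc.prems False by (intro Suc.IH) simp_all
    finally show ?thesis by (simp add: algebra_simps)
  qed simp
qed simp

lemma smallest_eigval_quad_le:
  fixes G :: "real^'n^'n"
  assumes "G \<in> sym_mats"
  shows "eigval G CARD('n) * (x \<bullet> x) \<le> x \<bullet> (G *v x)"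
proof -
  obtain v where v: "eigenbasis G v" using sym_mats_spectral(1)[OF assms] by blast
  have "eigval G CARD('n) * (x \<bullet> x) = (\<Sum>i=1..CARD('n). eigval G CARD('n) * (x \<bullet> v i)\<^sup>2)"
    by (subst orthonormal_on_parseval[OF eigenbasisD(1)[OF v]])
      (simp add: power2_eq_square sum_distrib_left)
  also have "\<dots> \<le> (\<Sum>i=1..CARD('n). eigval G i * (x \<bullet> v i)\<^sup>2)"
    using sym_mats_spectral(2)[OF assms] by (intro sum_mono mult_right_mono) auto
  also have "\<dots> = x \<bullet> (G *v x)" by (rule eigenbasis_quad[OF v, symmetric])
  finally show ?thesis .
qed

text \<open>The right-hand side equals the sum of \<open>eigval G j * s j\<close> with weights in
  [0,1] by Bessel and total mass \<open>k\<close> by Parseval. Such a sum is least when the mass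
  sits on the \<open>k\<close> smallest eigenvalues.\<close>

lemma ky_fan:
  fixes G :: "real^'n^'n"
  assumes G: "G \<in> sym_mats" and k: "k \<le> CARD('n)" and u: "orthonormal_on {1..k} u"
  shows "(\<Sum>j=1..k. eigval G (CARD('n) + 1 - j)) \<le> (\<Sum>i=1..k. u i \<bullet> (G *v u i))"
proof (cases "k = 0")
  case False
  let ?n = "CARD('n)"
  obtain v where v: "eigenbasis G v" using sym_mats_spectral(1)[OF G] by blast
  note on = eigenbasisD(1)[OF v]
  define s where "s j = (\<Sum>i=1..k. (u i \<bullet> v j)\<^sup>2)" for j
  \<comment> \<open>The \<open>k\<close>-th smallest eigenvalue. Subtracting it everywhere costs
    \<open>c * k\<close> on both sides and makes the comparison termwise: the shifted eigenvalues
    are nonpositive on \<open>J\<close> and nonnegative off it.\<close>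
  define c where "c = eigval G (?n + 1 - k)"
  define J where "J = {?n + 1 - k..?n}"
  have s0: "0 \<le> s j" for j by (simp add: s_def sum_nonneg)
  have s1: "s j \<le> 1" if "j \<in> {1..?n}" for j
  proof -
    have "s j = (\<Sum>i=1..k. (v j \<bullet> u i)\<^sup>2)" by (simp add: s_def inner_commute)
    also have "\<dots> \<le> v j \<bullet> v j" by (rule orthonormal_on_bessel[OF u]) simp
    also have "\<dots> = 1" using on that by (simp add: orthonormal_on_def)
    finally show ?thesis .
  qed
  have "(\<Sum>j=1..?n. s j) = (\<Sum>i=1..k. \<Sum>j=1..?n. (u i \<bullet> v j)\<^sup>2)"
    unfolding s_def by (rule sum.swap)
  also have "\<dots> = (\<Sum>i=1..k. u i \<bullet> u i)"
    by (subst orthonormal_on_parseval[OF on]) (simp add: power2_eq_square)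
  also have "\<dots> = real k" using u by (simp add: orthonormal_on_def)
  finally have sk: "(\<Sum>j=1..?n. s j) = real k" .
  have cardJ: "card J = k" using k False by (simp add: J_def)
  have JN: "J \<subseteq> {1..?n}" using k by (auto simp: J_def)
  have "(\<Sum>j=1..k. eigval G (?n + 1 - j)) - c * k = (\<Sum>j\<in>J. eigval G j) - c * k"
    using k by (intro arg_cong[where f="\<lambda>x. x - c * k"]
        sum.reindex_bij_witness[where i="\<lambda>j. ?n + 1 - j" and j="\<lambda>j. ?n + 1 - j"]) (auto simp: J_def)
  also have "\<dots> = (\<Sum>j\<in>J. eigval G j - c)" by (simp add: sum_subtractf cardJ)
  also have "\<dots> = (\<Sum>j=1..?n. if j \<in> J then eigval G j - c else 0)"
    using JN by (simp add: sum.inter_restrict[symmetric] Int_absorb1)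
  also have "\<dots> \<le> (\<Sum>j=1..?n. (eigval G j - c) * s j)"
  proof (rule sum_mono)
    fix j assume j: "j \<in> {1..?n}"
    show "(if j \<in> J then eigval G j - c else 0) \<le> (eigval G j - c) * s j"
    proof (cases "j \<in> J")
      case True
      then have "eigval G j - c \<le> 0"
        using sym_mats_spectral(2)[OF G, of "?n + 1 - k" j] k j by (auto simp: c_def J_def)
      then show ?thesis using True s1[OF j] mult_left_mono_neg[of "s j" 1 "eigval G j - c"] by simp
    next
      case nJ: False
      then have "0 \<le> eigval G j - c"
        using sym_mats_spectral(2)[OF G, of j "?n + 1 - k"] k j False by (auto simp: c_def J_def)
      then show ?thesis using nJ s0[of j] by simp
    qed
  qed
  also have "\<dots> = (\<Sum>j=1..?n. eigval G j * s j) - c * k"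
    by (simp add: left_diff_distrib sum_subtractf sum_distrib_left[symmetric] sk[simplified])
  also have "(\<Sum>j=1..?n. eigval G j * s j) = (\<Sum>i=1..k. \<Sum>j=1..?n. eigval G j * (u i \<bullet> v j)\<^sup>2)"
    unfolding s_def sum_distrib_left by (rule sum.swap)
  also have "\<dots> = (\<Sum>i=1..k. u i \<bullet> (G *v u i))"
    by (simp only: eigenbasis_quad[OF v])
  finally show ?thesis by simp
qed simp

section \<open>Geometry of the spectrahedron\<close>

lemma subspace_sym_mats: "subspace sym_mats"
  by (auto simp: subspace_def sym_mats_def transpose_def vec_eq_iff)

lemma outer_sym: "outer u \<in> sym_mats"
  by (simp add: sym_mats_def outer_def transpose_def vec_eq_iff mult.commute)

lemma spectrahedron_sym: "Z \<in> spectrahedron \<Longrightarrow> Z \<in> sym_mats"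
  by (simp add: spectrahedron_def)

lemma spectrahedron_eigval_nonneg:
  fixes Z :: "real^'n^'n"
  assumes "Z \<in> spectrahedron" shows "0 \<le> eigval Z i"
proof (cases "i \<in> {1..CARD('n)}")
  case True
  obtain u where u: "eigenbasis Z u"
    using sym_mats_spectral(1)[OF spectrahedron_sym[OF assms]] by blast
  have "0 \<le> u i \<bullet> (Z *v u i)" using assms by (simp add: spectrahedron_def)
  also have "\<dots> = eigval Z i"
    using eigenbasisD[OF u] True by (simp add: orthonormal_on_def)
  finally show ?thesis .
qed (auto simp: eigval_def)

lemma spectrahedron_sum_eigval:
  fixes Z :: "real^'n^'n"
  assumes "Z \<in> spectrahedron" shows "(\<Sum>i=1..CARD('n). eigval Z i) = 1"
proof -
  obtain u where u: "eigenbasis Z u"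
    using sym_mats_spectral(1)[OF spectrahedron_sym[OF assms]] by blast
  then show ?thesis using eigenbasis_trace[OF u] assms by (simp add: spectrahedron_def)
qed

lemma spectrahedron_inner_nonneg:
  fixes X Z :: "real^'n^'n"
  assumes "X \<in> spectrahedron" "Z \<in> spectrahedron" shows "0 \<le> X \<bullet> Z"
proof -
  obtain u where u: "eigenbasis Z u"
    using sym_mats_spectral(1)[OF spectrahedron_sym[OF assms(2)]] by blast
  show ?thesis
    unfolding eigenbasis_inner[OF u] using assms(1) spectrahedron_eigval_nonneg[OF assms(2)]
    by (intro sum_nonneg mult_nonneg_nonneg) (simp_all add: spectrahedron_def)
qed

text \<open>The squared norm is the sum of the squared eigenvalues, which are nonnegative, add up to
  1 and hence are at most 1 each.\<close>

lemma spectrahedron_inner_self_le: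
  fixes Z :: "real^'n^'n"
  assumes "Z \<in> spectrahedron" shows "Z \<bullet> Z \<le> 1"
proof -
  obtain u where u: "eigenbasis Z u"
    using sym_mats_spectral(1)[OF spectrahedron_sym[OF assms]] by blast
  note nn = spectrahedron_eigval_nonneg[OF assms]
  note s1 = spectrahedron_sum_eigval[OF assms]
  have "Z \<bullet> Z = (\<Sum>i=1..CARD('n). eigval Z i * eigval Z i)"
    unfolding eigenbasis_inner[OF u]
    using eigenbasisD[OF u] by (intro sum.cong) (simp_all add: orthonormal_on_def)
  also have "\<dots> \<le> (\<Sum>i=1..CARD('n). eigval Z i * 1)"
    using nn member_le_sum[of _ "{1..CARD('n)}" "eigval Z"] s1
    by (intro sum_mono mult_left_mono) auto
  finally show ?thesis using s1 by simp
qed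

text \<open>In the expanded square the two norms contribute at most 1 each, and the cross term is
  nonpositive.\<close>

lemma spectrahedron_diam:
  fixes X Z :: "real^'n^'n"
  assumes "X \<in> spectrahedron" "Z \<in> spectrahedron" shows "(norm (X - Z))\<^sup>2 \<le> 2"
  using spectrahedron_inner_nonneg[OF assms] spectrahedron_inner_self_le[OF assms(1)]
    spectrahedron_inner_self_le[OF assms(2)]
  by (simp add: power2_norm_eq_inner inner_diff_left inner_diff_right inner_commute[of Z X])

text \<open>Trace and positivity are here linear conditions on \<open>X\<close>, from which
  convexity and closedness are immediate.\<close>

lemma spectrahedron_inner_form:
  "spectrahedron = {X \<in> sym_mats. X \<bullet> mat 1 = 1 \<and> (\<forall>u. 0 \<le> X \<bullet> outer u)}"
  by (simp add: spectrahedron_def trace_eq_inner inner_outer)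

lemma convex_spectrahedron: "convex (spectrahedron :: (real^'n^'n) set)"
  unfolding convex_def spectrahedron_inner_form
  by (auto simp: inner_add_left intro!: subspace_add[OF subspace_sym_mats] subspace_scale[OF subspace_sym_mats])

lemma compact_spectrahedron: "compact (spectrahedron :: (real^'n^'n) set)"
proof -
  have "spectrahedron = sym_mats \<inter> {X :: real^'n^'n. X \<bullet> mat 1 = 1} \<inter> (\<Inter>u. {X. 0 \<le> X \<bullet> outer u})"
    by (auto simp: spectrahedron_inner_form)
  moreover have "closed \<dots>"
    by (intro closed_Int closed_INT ballI closed_subspace subspace_sym_mats closed_Collect_eq
        closed_Collect_le continuous_intros)
  moreover have "bounded (spectrahedron :: (real^'n^'n) set)"
    using spectrahedron_inner_self_le
    by (intro boundedI[where B=1]) (simp add: norm_eq_sqrt_inner)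
  ultimately show ?thesis by (simp add: compact_eq_bounded_closed)
qed

text \<open>If \<open>eigval Z i\<close> were positive, the first \<open>i\<close> eigenvectors
  would all have positive eigenvalues and lie in the range of \<open>Z\<close>, so the rank would be
  at least \<open>i\<close>.\<close>

lemma spectrahedron_rank_eigval:
  fixes Z :: "real^'n^'n"
  assumes Z: "Z \<in> spectrahedron" and i: "rank Z < i"
  shows "eigval Z i = 0"
proof (rule ccontr)
  assume nz: "eigval Z i \<noteq> 0"
  then have pos: "0 < eigval Z i" and iN: "i \<in> {1..CARD('n)}"
    using spectrahedron_eigval_nonneg[OF Z, of i] by (auto simp: eigval_def split: if_splits)
  obtain u where u: "eigenbasis Z u"
    using sym_mats_spectral(1)[OF spectrahedron_sym[OF Z]] by blast
  have "u j \<in> range ((*v) Z)" if "j \<in> {1..i}" for j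
  proof -
    have "0 < eigval Z j"
      using sym_mats_spectral(2)[OF spectrahedron_sym[OF Z], of j i] pos that iN by auto
    then have "Z *v (u j /\<^sub>R eigval Z j) = u j"
      using eigenbasisD(2)[OF u, of j] that iN by (simp add: matrix_vector_mult_scaleR)
    then show ?thesis by (metis rangeI)
  qed
  then have "u ` {1..i} \<subseteq> range ((*v) Z)" by auto
  then have "dim (u ` {1..i}) \<le> rank Z" by (simp add: rank_dim_range dim_subset)
  moreover have "dim (u ` {1..i}) = i"
    using orthonormal_on_dim_span[OF orthonormal_on_subset[OF eigenbasisD(1)[OF u], of "{1..i}"]] iN
    by simp
  ultimately show False using i by simp
qed

text \<open>The eigenvalue mass of \<open>Z\<close> in excess of the \<open>a i\<close> costs at
  least the smallest eigenvalue of \<open>G\<close>; Ky Fan and summation by parts bound the cost of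
  the \<open>a i\<close> themselves. For \<open>a i = eigval X i - d\<close> the left-hand side is
  the value attained by the thresholding mapping.\<close>

lemma spectrahedron_inner_ge:
  fixes G Z :: "real^'n^'n"
  assumes G: "G \<in> sym_mats" and Z: "Z \<in> spectrahedron" and r: "r \<le> CARD('n)"
    and a: "\<And>i. i \<in> {1..r} \<Longrightarrow> 0 \<le> a i \<and> a i \<le> eigval Z i"
    and anti: "\<And>i j. \<lbrakk>1 \<le> i; i \<le> j; j \<le> r\<rbrakk> \<Longrightarrow> a j \<le> a i"
  shows "(\<Sum>i=1..r. a i * eigval G (CARD('n) + 1 - i)) + (1 - (\<Sum>i=1..r. a i)) * eigval G CARD('n) \<le> G \<bullet> Z"
proof -
  let ?n = "CARD('n)"
  obtain u where u: "eigenbasis Z u"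
    using sym_mats_spectral(1)[OF spectrahedron_sym[OF Z]] by blast
  note on = eigenbasisD(1)[OF u]
  define q where "q i = u i \<bullet> (G *v u i)" for i
  define l where "l = eigval G ?n"
  \<comment> \<open>The weights \<open>a\<close> extended by zero, so that sums up to
    \<open>r\<close> and up to \<open>?n\<close> can be compared termwise.\<close>
  define b where "b i = (if i \<in> {1..r} then a i else 0)" for i
  have restr: "(\<Sum>i=1..?n. b i * x i) = (\<Sum>i=1..r. a i * x i)" for x
  proof -
    have "(\<Sum>i=1..r. a i * x i) = (\<Sum>i\<in>{1..?n} \<inter> {1..r}. a i * x i)"
      using r by (intro sum.cong) auto
    also have "\<dots> = (\<Sum>i\<in>{1..?n}. if i \<in> {1..r} then a i * x i else 0)"
      by (rule sum.inter_restrict) simp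
    also have "\<dots> = (\<Sum>i=1..?n. b i * x i)" by (intro sum.cong) (auto simp: b_def)
    finally show ?thesis by simp
  qed
  have ql: "l \<le> q i" if "i \<in> {1..?n}" for i
    using smallest_eigval_quad_le[OF G, of "u i"] on that by (simp add: q_def l_def orthonormal_on_def)
  have "0 \<le> (\<Sum>i=1..?n. (eigval Z i - b i) * (q i - l))"
    using ql a spectrahedron_eigval_nonneg[OF Z]
    by (intro sum_nonneg mult_nonneg_nonneg) (auto simp: b_def)
  also have "\<dots> = (\<Sum>i=1..?n. eigval Z i * q i) - l * (\<Sum>i=1..?n. eigval Z i) - (\<Sum>i=1..?n. b i * q i) + l * (\<Sum>i=1..?n. b i * 1)"
    by (simp add: algebra_simps sum.distrib sum_subtractf sum_distrib_left)
  also have "\<dots> = G \<bullet> Z - l - (\<Sum>i=1..r. a i * q i) + l * (\<Sum>i=1..r. a i)"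
    unfolding restr spectrahedron_sum_eigval[OF Z] by (simp add: eigenbasis_inner[OF u] q_def)
  finally have 1: "(\<Sum>i=1..r. a i * q i) + (1 - (\<Sum>i=1..r. a i)) * l \<le> G \<bullet> Z"
    by (simp add: algebra_simps)
  \<comment> \<open>Ky Fan makes every partial sum of the differences nonnegative, which is what
    summation by parts with the nonincreasing weights \<open>a\<close> requires.\<close>
  have "0 \<le> (\<Sum>i=1..r. a i * (q i - eigval G (?n + 1 - i)))"
  proof (cases "r = 0")
    case False
    have ps: "0 \<le> (\<Sum>i=1..k. q i - eigval G (?n + 1 - i))" if "k \<le> r" for k
    proof -
      have "orthonormal_on {1..k} u" by (rule orthonormal_on_subset[OF on]) (use r that in auto)
      then show ?thesis using ky_fan[OF G, of k u] r that by (simp add: sum_subtractf q_def)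
    qed
    have "0 \<le> a r * (\<Sum>i=1..r. q i - eigval G (?n + 1 - i))"
      using a[of r] ps[of r] False by simp
    also have "\<dots> \<le> (\<Sum>i=1..r. a i * (q i - eigval G (?n + 1 - i)))"
      using anti ps False by (intro sum_mult_antimono_ge) auto
    finally show ?thesis .
  qed simp
  then show ?thesis using 1 by (simp add: right_diff_distrib sum_subtractf l_def)
qed

text \<open>The last coefficient \<open>n * dhat\<close> is the trace missing from the first
  \<open>r\<close> terms. In this form \<open>r = 0\<close> is just the empty sum, and no case
  distinction remains.\<close>

lemma thresh_map_eq:
  fixes X :: "real^'n^'n"
  shows "thresh_map X v d r = (\<Sum>i=1..r. (eigval X i - d) *\<^sub>R outer (v (CARD('n) + 1 - i)))
    + (1 - (\<Sum>i=1..r. eigval X i - d)) *\<^sub>R outer (v CARD('n))"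
proof (cases "r = 0")
  case False
  have "real CARD('n) * ((1 + real r * d - (\<Sum>i=1..r. eigval X i)) / real CARD('n)) =
      1 - (\<Sum>i=1..r. eigval X i - d)"
    by (simp add: sum_subtractf)
  then show ?thesis using False by (simp only: thresh_map_def Let_def if_False)
qed (simp add: thresh_map_def)

lemma thresh_map_inner:
  fixes X G :: "real^'n^'n"
  assumes v: "eigenbasis G v" and r: "r \<le> CARD('n)"
  shows "G \<bullet> thresh_map X v d r = (\<Sum>i=1..r. (eigval X i - d) * eigval G (CARD('n) + 1 - i))
    + (1 - (\<Sum>i=1..r. eigval X i - d)) * eigval G CARD('n)"
proof -
  have e: "G \<bullet> outer (v j) = eigval G j" if "j \<in> {1..CARD('n)}" for j
    using eigenbasisD[OF v] that by (simp add: inner_outer orthonormal_on_def)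
  have "(\<Sum>i=1..r. (eigval X i - d) * (G \<bullet> outer (v (CARD('n) + 1 - i)))) =
      (\<Sum>i=1..r. (eigval X i - d) * eigval G (CARD('n) + 1 - i))"
  proof (rule sum.cong[OF refl])
    fix i assume "i \<in> {1..r}"
    then have "CARD('n) + 1 - i \<in> {1..CARD('n)}" using r by auto
    from e[OF this] show "(eigval X i - d) * (G \<bullet> outer (v (CARD('n) + 1 - i))) =
      (eigval X i - d) * eigval G (CARD('n) + 1 - i)" by simp
  qed
  moreover have "G \<bullet> outer (v CARD('n)) = eigval G CARD('n)" by (rule e) simp
  ultimately show ?thesis
    by (simp add: thresh_map_eq inner_add_right inner_sum_right)
qed

text \<open>The mapping is a combination of rank-one projections with coefficients adding up to 1.
  The last coefficient is nonnegative because the thresholded eigenvalues sum to at most the trace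
  of \<open>X\<close>.\<close>

lemma thresh_map_in_spectrahedron:
  fixes X G :: "real^'n^'n"
  assumes X: "X \<in> spectrahedron" and v: "eigenbasis G v" and r: "r \<le> CARD('n)" and d: "0 \<le> d"
    and thr: "\<And>i. i \<in> {1..r} \<Longrightarrow> d \<le> eigval X i"
  shows "thresh_map X v d r \<in> spectrahedron"
proof -
  have tr: "outer (v j) \<bullet> mat 1 = 1" if "j \<in> {1..CARD('n)}" for j
    using eigenbasisD(1)[OF v] that by (simp add: inner_commute[of "outer _"] inner_outer orthonormal_on_def)
  have pos: "0 \<le> outer w \<bullet> outer u" for w u :: "real^'n"
    by (simp add: inner_outer outer_mult_vec inner_commute)
  have "(\<Sum>i=1..r. eigval X i - d) \<le> (\<Sum>i=1..r. eigval X i)"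
    using d by (intro sum_mono) simp
  also have "\<dots> \<le> (\<Sum>i=1..CARD('n). eigval X i)"
    using r spectrahedron_eigval_nonneg[OF X] by (intro sum_mono2) auto
  finally have c: "(\<Sum>i=1..r. eigval X i - d) \<le> 1" by (simp add: spectrahedron_sum_eigval[OF X, simplified])
  let ?Y = "thresh_map X v d r"
  have "?Y \<in> sym_mats"
    unfolding thresh_map_eq
    by (intro subspace_add[OF subspace_sym_mats] subspace_sum[OF subspace_sym_mats]
        subspace_scale[OF subspace_sym_mats] outer_sym)
  moreover have "?Y \<bullet> mat 1 = 1"
  proof -
    have "(\<Sum>i=1..r. (eigval X i - d) * (outer (v (CARD('n) + 1 - i)) \<bullet> mat 1)) = (\<Sum>i=1..r. eigval X i - d)"
    proof (rule sum.cong[OF refl])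
      fix i assume "i \<in> {1..r}"
      then have "CARD('n) + 1 - i \<in> {1..CARD('n)}" using r by auto
      from tr[OF this] show "(eigval X i - d) * (outer (v (CARD('n) + 1 - i)) \<bullet> mat 1) = eigval X i - d"
        by simp
    qed
    moreover have "outer (v CARD('n)) \<bullet> mat 1 = 1" by (rule tr) simp
    ultimately show ?thesis by (simp add: thresh_map_eq inner_add_left inner_sum_left)
  qed
  moreover have "0 \<le> ?Y \<bullet> outer u" for u
    unfolding thresh_map_eq inner_add_left inner_sum_left inner_scaleR_left
    using thr c pos by (intro add_nonneg_nonneg sum_nonneg mult_nonneg_nonneg) auto
  ultimately show ?thesis by (simp add: spectrahedron_inner_form)
qed

text \<open>By Weyl, \<open>eigval X i - d \<le> eigval Z i\<close>, so \<open>Z\<close> is a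
  competitor in \<open>spectrahedron_inner_ge\<close>, whose bound the mapping attains.\<close>

lemma thresh_map_inner_le:
  fixes X Z G :: "real^'n^'n"
  assumes X: "X \<in> spectrahedron" and Z: "Z \<in> spectrahedron" and dist: "norm (X - Z) \<le> d"
    and G: "G \<in> sym_mats" and v: "eigenbasis G v" and r: "r \<le> CARD('n)"
    and thr: "\<And>i. i \<in> {1..r} \<Longrightarrow> d \<le> eigval X i"
  shows "G \<bullet> thresh_map X v d r \<le> G \<bullet> Z"
  unfolding thresh_map_inner[OF v r]
proof (rule spectrahedron_inner_ge[OF G Z r])
  show "0 \<le> eigval X i - d \<and> eigval X i - d \<le> eigval Z i" if "i \<in> {1..r}" for i
    using thr[OF that] weyl_perturbation[OF X[THEN spectrahedron_sym] Z[THEN spectrahedron_sym], of i]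
      that r dist by auto
  show "eigval X j - d \<le> eigval X i - d" if "1 \<le> i" "i \<le> j" "j \<le> r" for i j
    using sym_mats_spectral(2)[OF spectrahedron_sym[OF X], of i j] that r by simp
qed

section \<open>Smooth convex functions on the spectrahedron\<close>

lemma segment_in_spectrahedron:
  fixes X Y :: "real^'n^'n"
  assumes "X \<in> spectrahedron" "Y \<in> spectrahedron" "s \<in> {0..1}"
  shows "X + s *\<^sub>R (Y - X) \<in> spectrahedron"
  using convexD_alt[OF convex_spectrahedron assms(1,2), of s] assms(3)
  by (simp add: algebra_simps)

text \<open>The gradient is a derivative within \<open>sym_mats\<close> only; the chain rule applies
  because the segment stays there.\<close>

lemma line_has_real_derivative:
  fixes f :: "real^'n^'n \<Rightarrow> real"
  assumes gradient: "\<And>Z. Z \<in> spectrahedron \<Longrightarrow> is_sym_gradient f Z (grad Z)"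
    and X: "X \<in> spectrahedron" and Y: "Y \<in> spectrahedron" and s: "s \<in> {0..1}"
  shows "((\<lambda>s. f (X + s *\<^sub>R (Y - X))) has_real_derivative grad (X + s *\<^sub>R (Y - X)) \<bullet> (Y - X))
    (at s within {0..1})"
proof -
  let ?g = "\<lambda>s. X + s *\<^sub>R (Y - X)"
  have "(?g has_derivative (\<lambda>h. h *\<^sub>R (Y - X))) (at s within {0..1})"
    by (auto intro!: derivative_eq_intros)
  moreover have "(f has_derivative (\<lambda>H. grad (?g s) \<bullet> H)) (at (?g s) within ?g ` {0..1})"
  proof (rule has_derivative_subset)
    show "(f has_derivative (\<lambda>H. grad (?g s) \<bullet> H)) (at (?g s) within sym_mats)"
      using gradient[OF segment_in_spectrahedron[OF X Y s]] by (simp add: is_sym_gradient_def)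
    show "?g ` {0..1} \<subseteq> sym_mats"
      using segment_in_spectrahedron[OF X Y] spectrahedron_sym by blast
  qed
  ultimately have "((\<lambda>s. f (?g s)) has_derivative (\<lambda>h. grad (?g s) \<bullet> (h *\<^sub>R (Y - X)))) (at s within {0..1})"
    by (rule has_derivative_in_compose)
  then show ?thesis
    unfolding has_field_derivative_def
    by (rule has_derivative_eq_rhs) (simp add: fun_eq_iff mult.commute)
qed

text \<open>By convexity every difference quotient along the segment is at most
  \<open>f Y - f X\<close>, hence so is its limit at 0.\<close>

lemma gradient_inequality:
  fixes f :: "real^'n^'n \<Rightarrow> real"
  assumes convex: "convex_on spectrahedron f"
    and gradient: "\<And>Z. Z \<in> spectrahedron \<Longrightarrow> is_sym_gradient f Z (grad Z)"
    and X: "X \<in> spectrahedron" and Y: "Y \<in> spectrahedron"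
  shows "f X + grad X \<bullet> (Y - X) \<le> f Y"
proof -
  define p where "p s = f (X + s *\<^sub>R (Y - X))" for s
  have "(p has_real_derivative grad X \<bullet> (Y - X)) (at 0 within {0..1})"
    using line_has_real_derivative[OF gradient X Y, of 0] by (simp add: p_def[abs_def])
  then have "((\<lambda>s. (p s - p 0) / (s - 0)) \<longlongrightarrow> grad X \<bullet> (Y - X)) (at 0 within {0..1})"
    by (simp add: has_field_derivative_iff)
  moreover have "\<forall>\<^sub>F s in at 0 within {0..1}. (p s - p 0) / (s - 0) \<le> f Y - f X"
    unfolding eventually_at_filter
  proof (intro always_eventually allI impI)
    fix s :: real assume s: "s \<noteq> 0" "s \<in> {0..1}"
    have "f ((1 - s) *\<^sub>R X + s *\<^sub>R Y) \<le> (1 - s) * f X + s * f Y"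
      using convex_onD[OF convex, of s X Y] X Y s by simp
    moreover have "X + s *\<^sub>R (Y - X) = (1 - s) *\<^sub>R X + s *\<^sub>R Y" by (simp add: algebra_simps)
    ultimately have "p s - p 0 \<le> s * (f Y - f X)" by (simp add: p_def algebra_simps)
    then show "(p s - p 0) / (s - 0) \<le> f Y - f X" using s by (simp add: field_simps)
  qed
  moreover have "at (0::real) within {0..1} \<noteq> bot"
    by (simp add: at_within_Icc_at_right)
  ultimately have "grad X \<bullet> (Y - X) \<le> f Y - f X"
    by (intro tendsto_upperbound)
  then show ?thesis by simp
qed

text \<open>The function \<open>p\<close> is \<open>f\<close> on the segment minus the linear and
  quadratic terms of the model. Cauchy-Schwarz and the Lipschitz bound make its derivative
  nonpositive, and \<open>p 1 \<le> p 0\<close> is the claim.\<close>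

lemma descent_inequality:
  fixes f :: "real^'n^'n \<Rightarrow> real"
  assumes gradient: "\<And>Z. Z \<in> spectrahedron \<Longrightarrow> is_sym_gradient f Z (grad Z)"
    and smooth: "L_smooth grad L"
    and X: "X \<in> spectrahedron" and Y: "Y \<in> spectrahedron"
  shows "f Y \<le> f X + grad X \<bullet> (Y - X) + L / 2 * (norm (Y - X))\<^sup>2"
proof -
  let ?g = "\<lambda>s. X + s *\<^sub>R (Y - X)"
  define N where "N = (norm (Y - X))\<^sup>2"
  define p where "p s = f (?g s) - (s * (grad X \<bullet> (Y - X)) + L / 2 * s\<^sup>2 * N)" for s
  have deriv: "(p has_real_derivative grad (?g s) \<bullet> (Y - X) - grad X \<bullet> (Y - X) - L * s * N) (at s within {0..1})"
    if "s \<in> {0..1}" for s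
  proof -
    have "((\<lambda>s. s * (grad X \<bullet> (Y - X)) + L / 2 * s\<^sup>2 * N) has_real_derivative
        grad X \<bullet> (Y - X) + L * s * N) (at s within {0..1})"
      by (auto intro!: derivative_eq_intros)
    from DERIV_diff[OF line_has_real_derivative[OF gradient X Y that] this] show ?thesis
      by (simp add: p_def[abs_def] diff_diff_eq)
  qed
  have "p 1 \<le> p 0"
  proof (rule DERIV_nonpos_imp_decreasing_open[of 0 1])
    show "continuous_on {0..1} p"
      unfolding continuous_on_eq_continuous_within by (intro ballI DERIV_continuous[OF deriv])
    fix s :: real assume s: "0 < s" "s < 1"
    have "(grad (?g s) - grad X) \<bullet> (Y - X) \<le> norm (grad (?g s) - grad X) * norm (Y - X)"
      by (rule norm_cauchy_schwarz)
    also have "\<dots> \<le> L * norm (?g s - X) * norm (Y - X)"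
    proof (rule mult_right_mono)
      have "?g s \<in> spectrahedron" using segment_in_spectrahedron[OF X Y, of s] s by simp
      then show "norm (grad (?g s) - grad X) \<le> L * norm (?g s - X)"
        using smooth X unfolding L_smooth_def by blast
    qed simp
    also have "\<dots> = L * s * N" using s by (simp add: N_def power2_eq_square)
    finally have "grad (?g s) \<bullet> (Y - X) - grad X \<bullet> (Y - X) - L * s * N \<le> 0"
      by (simp add: inner_diff_left)
    then show "\<exists>y. (p has_real_derivative y) (at s) \<and> y \<le> 0"
      using deriv[of s] s at_within_Icc_at[of 0 s 1] by auto
  qed simp
  then show ?thesis by (simp add: p_def N_def algebra_simps)
qed

text \<open>By compactness the minimizers form a nonempty level set of a continuous function.
  Closedness serves to attain the distance to this set.\<close>

lemma minimizers_attained: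
  fixes f :: "real^'n^'n \<Rightarrow> real"
  assumes cont: "continuous_on spectrahedron f" and ne: "spectrahedron \<noteq> ({} :: (real^'n^'n) set)"
  shows "minimizers f \<noteq> {}" "closed (minimizers f)"
    and "Z \<in> minimizers f \<Longrightarrow> f Z = min_value f"
proof -
  obtain M where M: "M \<in> spectrahedron" "\<And>Y. Y \<in> spectrahedron \<Longrightarrow> f M \<le> f Y"
    using continuous_attains_inf[OF compact_spectrahedron ne cont] by blast
  have mM: "min_value f = f M"
    unfolding min_value_def using M by (intro cInf_eq_minimum) auto
  have e: "minimizers f = {Z \<in> spectrahedron. f Z = f M}"
  proof (intro set_eqI iffI)
    fix Z assume "Z \<in> minimizers f"
    then have Z: "Z \<in> spectrahedron" "\<not> f M < f Z"
      using M(1) by (auto simp: minimizers_def is_arg_min_def)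
    then show "Z \<in> {Z \<in> spectrahedron. f Z = f M}" using M(2)[OF Z(1)] by simp
  next
    fix Z assume "Z \<in> {Z \<in> spectrahedron. f Z = f M}"
    then show "Z \<in> minimizers f"
      using M(2) by (auto simp: minimizers_def is_arg_min_def not_less)
  qed
  show "minimizers f \<noteq> {}" using M e by auto
  show "Z \<in> minimizers f \<Longrightarrow> f Z = min_value f" using e mM by simp
  show "closed (minimizers f)"
    unfolding e by (rule continuous_closed_preimage_constant[OF cont compact_imp_closed[OF compact_spectrahedron]])
qed

lemma quadratic_growth_near:
  fixes f :: "real^'n^'n \<Rightarrow> real"
  assumes cont: "continuous_on spectrahedron f" and growth: "quadratic_growth f \<mu>"
    and X: "X \<in> spectrahedron"
  obtains Z where "Z \<in> minimizers f" "(norm (X - Z))\<^sup>2 \<le> 2 / \<mu> * (f X - min_value f)"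
proof -
  have ne: "spectrahedron \<noteq> ({} :: (real^'n^'n) set)" using X by auto
  obtain Z where Z: "Z \<in> minimizers f" "infdist X (minimizers f) = dist X Z"
    using infdist_attains_inf[OF minimizers_attained(2,1)[OF cont ne], of X] by blast
  have "(infdist X (minimizers f))\<^sup>2 \<le> 2 / \<mu> * (f X - min_value f)"
    using growth X unfolding quadratic_growth_def by (rule bspec)
  then show ?thesis
    using that[OF Z(1)] by (simp only: Z(2) dist_norm)
qed

section \<open>The efficient rank\<close>

text \<open>Eigenvalues at out-of-range indices are 0, so with \<open>0 \<le> d\<close> the strict
  inequality already places \<open>i\<close> in \<open>{1..CARD('n)}\<close>.\<close>

lemma thresh_rank_geI:
  fixes X :: "real^'n^'n"
  assumes "0 \<le> d" "d < eigval X i" shows "i \<le> thresh_rank d X"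
  using assms unfolding thresh_rank_def by (intro Max_ge) (auto simp: eigval_def split: if_splits)

lemma thresh_rank_gt:
  fixes X :: "real^'n^'n"
  assumes X: "X \<in> sym_mats" and i: "1 \<le> i" "i \<le> thresh_rank d X"
  shows "d < eigval X i" "i \<le> CARD('n)"
proof -
  let ?S = "insert 0 {i \<in> {1..CARD('n)}. d < eigval X i}"
  have "Max ?S \<in> ?S" by (intro Max_in) auto
  then have m: "thresh_rank d X \<le> CARD('n)" "d < eigval X (thresh_rank d X)"
    using i unfolding thresh_rank_def[symmetric] by auto
  then show "i \<le> CARD('n)" using i by simp
  show "d < eigval X i"
    using sym_mats_spectral(2)[OF X i m(1)] m(2) by simp
qed

text \<open>If the eigenvalue after index \<open>b\<close> is at most \<open>d\<close>, so are all
  later ones, and the search up to \<open>b\<close> finds the true thresholding rank; otherwise that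
  rank is at least \<open>b + 1\<close>. For \<open>b = CARD('n)\<close> the default value 0 selects
  the first branch.\<close>

lemma efficient_rank_eq:
  fixes X :: "real^'n^'n"
  assumes X: "X \<in> spectrahedron" and d: "0 \<le> d"
  shows "(if eigval X (b + 1) \<le> d then Max (insert 0 {i \<in> {1..b}. d < eigval X i}) else b + 1)
    = min (b + 1) (thresh_rank d X)"
proof (cases "eigval X (b + 1) \<le> d")
  case True
  have "i \<le> b" if "d < eigval X i" "1 \<le> i" for i
  proof (rule ccontr)
    assume "\<not> i \<le> b"
    moreover have "i \<le> CARD('n)"
      using that d by (auto simp: eigval_def split: if_splits)
    ultimately show False
      using sym_mats_spectral(2)[OF spectrahedron_sym[OF X], of "b + 1" i] that True by simp
  qed
  moreover have "i \<le> CARD('n)" if "d < eigval X i" for i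
    using that d by (auto simp: eigval_def split: if_splits)
  ultimately have "{i \<in> {1..b}. d < eigval X i} = {i \<in> {1..CARD('n)}. d < eigval X i}" by auto
  then have "Max (insert 0 {i \<in> {1..b}. d < eigval X i}) = thresh_rank d X"
    by (simp only: thresh_rank_def)
  moreover have "\<not> b + 1 \<le> thresh_rank d X"
    using thresh_rank_gt(1)[OF spectrahedron_sym[OF X], of "b + 1" d] True by auto
  ultimately show ?thesis using True by simp
next
  case False
  then have "b + 1 \<le> thresh_rank d X" by (intro thresh_rank_geI[OF d]) simp
  then show ?thesis using False by simp
qed

section \<open>Radius, rank bound and lower bound in one iteration\<close>

lemma continuous_on_spectrahedron:
  fixes f :: "real^'n^'n \<Rightarrow> real"
  assumes "\<And>Z. Z \<in> spectrahedron \<Longrightarrow> is_sym_gradient f Z (grad Z)"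
  shows "continuous_on spectrahedron f"
proof -
  have "spectrahedron \<subseteq> (sym_mats :: (real^'n^'n) set)" using spectrahedron_sym by blast
  then have "(f has_derivative (\<lambda>H. grad Z \<bullet> H)) (at Z within spectrahedron)"
    if "Z \<in> spectrahedron" for Z
    using assms[OF that] has_derivative_subset by (auto simp: is_sym_gradient_def)
  then show ?thesis
    unfolding continuous_on_eq_continuous_within by (intro ballI has_derivative_continuous)
qed

text \<open>Replacing the minimum value by a lower bound \<open>b\<close> only enlarges the radius;
  with \<open>b = B t\<close> it is the \<open>d t\<close> of the algorithm.\<close>

lemma quadratic_growth_radius:
  fixes f :: "real^'n^'n \<Rightarrow> real"
  assumes cont: "continuous_on spectrahedron f"
    and growth: "\<mu> > 0" "quadratic_growth f \<mu>"
    and X: "X \<in> spectrahedron" and b: "b \<le> min_value f"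
  obtains Z where "Z \<in> minimizers f" "norm (X - Z) \<le> sqrt (2 * (f X - b) / \<mu>)"
proof -
  obtain Z where Z: "Z \<in> minimizers f" "(norm (X - Z))\<^sup>2 \<le> 2 / \<mu> * (f X - min_value f)"
    using quadratic_growth_near[OF cont growth(2) X] .
  have "2 / \<mu> * (f X - min_value f) \<le> 2 / \<mu> * (f X - b)"
    using b growth(1) by (intro mult_left_mono) simp_all
  then have "(norm (X - Z))\<^sup>2 \<le> 2 * (f X - b) / \<mu>" using Z(2) by simp
  then show ?thesis by (intro that[OF Z(1)] real_le_rsqrt)
qed

lemma minimizers_spectrahedron: "Z \<in> minimizers f \<Longrightarrow> Z \<in> spectrahedron"
  by (simp add: minimizers_def is_arg_min_def)

lemma thresh_rank_le_rank:
  fixes X Z :: "real^'n^'n"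
  assumes X: "X \<in> spectrahedron" and Z: "Z \<in> spectrahedron" and near: "norm (X - Z) \<le> d"
  shows "thresh_rank d X \<le> rank Z"
proof (rule ccontr)
  let ?i = "thresh_rank d X"
  assume *: "\<not> ?i \<le> rank Z"
  then have "d < eigval X ?i" "?i \<in> {1..CARD('n)}"
    using thresh_rank_gt[OF spectrahedron_sym[OF X], of ?i d] by auto
  moreover have "eigval Z ?i = 0" using * by (intro spectrahedron_rank_eigval[OF Z]) simp
  ultimately show False
    using weyl_perturbation[OF spectrahedron_sym[OF X] spectrahedron_sym[OF Z], of ?i] near by simp
qed

text \<open>The linearization at the mapped point is at most that at the minimizer \<open>Z\<close>,
  which convexity bounds by the minimum value. Any cutoff up to the thresholding rank is allowed, so
  that the efficient rank is covered.\<close>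

lemma thresh_map_lower_bound:
  fixes f :: "real^'n^'n \<Rightarrow> real"
  assumes convex: "convex_on spectrahedron f"
    and gradient: "\<And>Z. Z \<in> spectrahedron \<Longrightarrow> is_sym_gradient f Z (grad Z)"
    and X: "X \<in> spectrahedron" and Z: "Z \<in> minimizers f" and near: "norm (X - Z) \<le> d"
    and v: "eigenbasis (grad X) v" and r: "r \<le> thresh_rank d X"
  shows "thresh_map X v d r \<in> spectrahedron"
    and "f X + grad X \<bullet> (thresh_map X v d r - X) \<le> min_value f"
proof -
  have d: "0 \<le> d" using near norm_ge_zero order_trans by blast
  note gt = thresh_rank_gt[OF spectrahedron_sym[OF X]]
  have thr: "d \<le> eigval X i" if "i \<in> {1..r}" for i
    using gt(1)[of i d] that r by simp
  have rn: "r \<le> CARD('n)"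
    using gt(2)[of r d] r by (cases "r = 0") simp_all
  have ZS: "Z \<in> spectrahedron" by (rule minimizers_spectrahedron[OF Z])
  have G: "grad X \<in> sym_mats" using gradient[OF X] by (simp add: is_sym_gradient_def)
  show "thresh_map X v d r \<in> spectrahedron"
    by (rule thresh_map_in_spectrahedron[OF X v rn d thr])
  have "grad X \<bullet> thresh_map X v d r \<le> grad X \<bullet> Z"
    by (rule thresh_map_inner_le[OF X ZS near G v rn thr])
  moreover have "f X + grad X \<bullet> (Z - X) \<le> f Z"
    by (rule gradient_inequality[OF convex gradient X ZS])
  moreover have "f Z = min_value f"
    using minimizers_attained(3)[OF continuous_on_spectrahedron[OF gradient] _ Z] ZS by blast
  ultimately show "f X + grad X \<bullet> (thresh_map X v d r - X) \<le> min_value f"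
    by (simp add: inner_diff_right)
qed

text \<open>The weight \<open>t * (t + 1)\<close> makes the recursion telescope, each step adding at
  most \<open>4 * c\<close>. It vanishes at \<open>t = 0\<close>, so the initial gap does not enter
  the bound.\<close>

lemma open_loop_rate:
  fixes g :: "nat \<Rightarrow> real"
  assumes "\<And>t. 1 \<le> t \<Longrightarrow> g t \<le> (1 - 2 / (real t + 1)) * g (t - 1) + (2 / (real t + 1))\<^sup>2 * c"
    and "0 \<le> c"
  shows "real t * (real t + 1) * g t \<le> 4 * c * real t"
proof (induction t)
  case (Suc t)
  have "(real t + 1) * (real t + 2) * g (Suc t) \<le>
      (real t + 1) * (real t + 2) * ((1 - 2 / (real t + 2)) * g t + (2 / (real t + 2))\<^sup>2 * c)"
    using assms(1)[of "Suc t"] by (intro mult_left_mono) (simp_all add: add.commute)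
  also have "\<dots> = real t * (real t + 1) * g t + 4 * c * ((real t + 1) / (real t + 2))"
  proof -
    have "u * (2 / u)\<^sup>2 = 4 / u" if "u \<noteq> 0" for u :: real
      using that by (simp add: power2_eq_square)
    from this[of "real t + 2"]
    have *: "(real t + 2) * (1 - 2 / (real t + 2)) = real t"
        "(real t + 2) * (2 / (real t + 2))\<^sup>2 = 4 / (real t + 2)"
      by (simp_all add: field_simps)
    have "x * y * (a * p + b * q) = x * ((y * a) * p + (y * b) * q)" for x y a b p q :: real
      by (simp add: algebra_simps)
    from this[of "real t + 1" "real t + 2" "1 - 2 / (real t + 2)" "g t" "(2 / (real t + 2))\<^sup>2" c]
    show ?thesis unfolding * by (simp add: algebra_simps)
  qed
  also have "\<dots> \<le> 4 * c * real t + 4 * c * 1"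
    using Suc assms(2) by (intro add_mono mult_left_mono) simp_all
  finally show ?case by (simp add: algebra_simps)
qed simp

theorem theorem4p4:
  fixes f :: "real^'n^'n \<Rightarrow> real"
    and grad :: "real^'n^'n \<Rightarrow> real^'n^'n"
    and L \<mu> T0 :: real
    and rstar :: nat
    and \<eta> :: "nat \<Rightarrow> real"
    and v :: "nat \<Rightarrow> nat \<Rightarrow> real^'n"
    and X Y :: "nat \<Rightarrow> real^'n^'n"
    and B d :: "nat \<Rightarrow> real"
    and r rhat :: "nat \<Rightarrow> nat"
  assumes convex: "convex_on spectrahedron f"
    and gradient: "\<And>Z. Z \<in> spectrahedron \<Longrightarrow> is_sym_gradient f Z (grad Z)"
    and smooth: "L > 0" "L_smooth grad L"
    and growth: "\<mu> > 0" "quadratic_growth f \<mu>"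
    and strict_compl: "strict_complementarity f grad rstar"
    and algorithm: "ERSO_FW f grad \<mu> \<eta> v X Y B d rhat"
    and steps: "open_loop_steps \<eta> \<or> line_search_steps f \<eta> X Y"
    and r_def: "\<And>t. t \<ge> 1 \<Longrightarrow> r t = thresh_rank (d (t - 1)) (X (t - 1))"
    and T0_def: "T0 = 72 * L / (\<mu> * (min_eigval f rstar)\<^sup>2)"
  shows "(\<forall>t\<ge>1. rhat t \<le> r t \<and> r t \<le> rstar) \<and>
         (\<forall>t\<ge>2. real t \<ge> T0 \<longrightarrow> r t = rstar) \<and>
         (\<forall>t\<ge>1. real t \<ge> T0 + real rstar \<longrightarrow> rhat t = r t \<and> r t = rstar)"
proof -

  \<comment> \<open>Invariants of the run\<close>
  let ?m = "min_value f"
  define l where "l = min_eigval f rstar"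
  define rbar where "rbar t = Max (rhat ` {..t})" for t
  note cont = continuous_on_spectrahedron[OF gradient]
  have rstar: "1 \<le> rstar" "rstar \<le> CARD('n)" and rank: "\<And>Z. Z \<in> minimizers f \<Longrightarrow> rank Z = rstar"
    and l0: "0 < l"
    using strict_compl by (auto simp: strict_complementarity_def l_def)
  have dt: "d t = sqrt (2 * (f (X t) - B t) / \<mu>)" for t
    using algorithm by (cases t) (auto simp: ERSO_FW_def)
  have step: "\<eta> t \<in> {0..1}"
      "rhat t = (if eigval (X (t - 1)) (rbar (t - 1) + 1) \<le> d (t - 1)
         then Max (insert 0 {i \<in> {1..rbar (t - 1)}. d (t - 1) < eigval (X (t - 1)) i})
         else rbar (t - 1) + 1)"
      "eigenbasis (grad (X (t - 1))) (v t)"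
      "Y t = thresh_map (X (t - 1)) (v t) (d (t - 1)) (rhat t)"
      "B t = max (B (t - 1)) (f (X (t - 1)) + grad (X (t - 1)) \<bullet> (Y t - X (t - 1)))"
      "X t = (1 - \<eta> t) *\<^sub>R X (t - 1) + \<eta> t *\<^sub>R Y t" if "t \<ge> 1" for t
    using algorithm that unfolding ERSO_FW_def Let_def rbar_def by blast+
  have near: "\<exists>Z\<in>minimizers f. norm (X t - Z) \<le> d t" if "X t \<in> spectrahedron" "B t \<le> ?m" for t
    using quadratic_growth_radius[OF cont growth that] dt[of t] by metis
  \<comment> \<open>Feasibility and the lower bound are premises here because this fact is used
    inside the induction that establishes them.\<close>
  have rhat_min: "rhat t = min (rbar (t - 1) + 1) (r t)"
    if "t \<ge> 1" "X (t - 1) \<in> spectrahedron" "B (t - 1) \<le> ?m" for t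
  proof -
    have "0 \<le> d (t - 1)" using near[OF that(2,3)] norm_ge_zero order_trans by blast
    from efficient_rank_eq[OF that(2) this] show ?thesis
      unfolding step(2)[OF that(1)] r_def[OF that(1)] .
  qed
  \<comment> \<open>\<open>d t\<close> is a valid radius because \<open>B t\<close> is a lower
    bound, and a valid radius makes the next \<open>B\<close> a lower bound; hence the two are
    propagated together with feasibility.\<close>
  have iter: "Y (Suc t) \<in> spectrahedron \<and> X (Suc t) \<in> spectrahedron \<and> B (Suc t) \<le> ?m"
    if "X t \<in> spectrahedron" "B t \<le> ?m" for t
  proof -
    obtain Z where Z: "Z \<in> minimizers f" "norm (X t - Z) \<le> d t" using near[OF \<open>X t \<in> _\<close> \<open>B t \<le> _\<close>] by blast
    have le: "rhat (Suc t) \<le> thresh_rank (d t) (X t)"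
      using rhat_min[of "Suc t"] that r_def[of "Suc t"] by simp
    have vt: "eigenbasis (grad (X t)) (v (Suc t))" using step(3)[of "Suc t"] by simp
    note Y = thresh_map_lower_bound[OF convex gradient that(1) Z vt le]
    have Yt: "Y (Suc t) = thresh_map (X t) (v (Suc t)) (d t) (rhat (Suc t))" using step(4)[of "Suc t"] by simp
    have "Y (Suc t) \<in> spectrahedron" unfolding Yt by (rule Y(1))
    moreover have "B (Suc t) \<le> ?m" using step(5)[of "Suc t"] Y(2) that(2) by (simp add: Yt)
    moreover have "X (Suc t) \<in> spectrahedron"
      using convexD_alt[OF convex_spectrahedron that(1) \<open>Y (Suc t) \<in> _\<close>, of "\<eta> (Suc t)"] step(1,6)[of "Suc t"] by simp
    ultimately show ?thesis by simp
  qed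
  have inv: "X t \<in> spectrahedron \<and> B t \<le> ?m" for t
  proof (induction t)
    case 0
    then show ?case using algorithm by (simp add: ERSO_FW_def)
  qed (use iter in blast)
  have Y_in: "Y (Suc t) \<in> spectrahedron" for t using iter inv by blast

  have part1: "rhat t = min (rbar (t - 1) + 1) (r t)" "r t \<le> rstar" if "t \<ge> 1" for t
  proof -
    show "rhat t = min (rbar (t - 1) + 1) (r t)" using rhat_min[OF that] inv by blast
    obtain Z where Z: "Z \<in> minimizers f" "norm (X (t - 1) - Z) \<le> d (t - 1)" using near inv by blast
    show "r t \<le> rstar"
      using thresh_rank_le_rank[OF _ minimizers_spectrahedron[OF Z(1)] Z(2)] inv
      by (simp add: r_def[OF that] rank[OF Z(1)])
  qed

  \<comment> \<open>Decay of the gap\<close>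
  define g where "g t = f (X t) - B t" for t
  have gap: "g t \<le> (1 - 2 / (real t + 1)) * g (t - 1) + (2 / (real t + 1))\<^sup>2 * L" if t: "1 \<le> t" for t
  proof -
    let ?s = "2 / (real t + 1)" and ?X = "X (t - 1)"
    have s: "?s \<in> {0..1}" using t by simp
    have XS: "?X \<in> spectrahedron" and YS: "Y t \<in> spectrahedron"
      using inv Y_in[of "t - 1"] t by auto
    \<comment> \<open>Line search does no worse than the open-loop step \<open>?s\<close>, so both
      rules are measured against the same point.\<close>
    have "f (X t) \<le> f (?X + ?s *\<^sub>R (Y t - ?X))"
    proof -
      have e: "?X + ?s *\<^sub>R (Y t - ?X) = (1 - ?s) *\<^sub>R ?X + ?s *\<^sub>R Y t" by (simp add: algebra_simps)
      from steps show ?thesis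
      proof
        assume "open_loop_steps \<eta>"
        then have "\<eta> t = ?s" using t by (simp add: open_loop_steps_def)
        then show ?thesis unfolding e step(6)[OF t] by simp
      next
        assume "line_search_steps f \<eta> X Y"
        then show ?thesis
          unfolding e step(6)[OF t] using t s
          by (auto simp: line_search_steps_def is_arg_min_def not_less)
      qed
    qed
    also have "\<dots> \<le> f ?X + grad ?X \<bullet> ((?X + ?s *\<^sub>R (Y t - ?X)) - ?X)
        + L / 2 * (norm ((?X + ?s *\<^sub>R (Y t - ?X)) - ?X))\<^sup>2"
      by (rule descent_inequality[OF gradient smooth(2) XS segment_in_spectrahedron[OF XS YS s]])
    also have "\<dots> = f ?X + ?s * (grad ?X \<bullet> (Y t - ?X)) + L / 2 * (?s\<^sup>2 * (norm (Y t - ?X))\<^sup>2)"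
      by (simp add: power_mult_distrib power_divide)
    \<comment> \<open>\<open>B t\<close> dominates the linearization at \<open>Y t\<close>, and the
      squared diameter 2 cancels the factor 1/2 of \<open>L\<close>.\<close>
    also have "\<dots> \<le> f ?X + ?s * (B t - f ?X) + L / 2 * (?s\<^sup>2 * 2)"
    proof -
      have "grad ?X \<bullet> (Y t - ?X) \<le> B t - f ?X" unfolding step(5)[OF t] by linarith
      then show ?thesis
        using spectrahedron_diam[OF YS XS] smooth(1)
        by (intro add_mono mult_left_mono order.refl) auto
    qed
    finally have "g t \<le> (1 - ?s) * (f ?X - B t) + ?s\<^sup>2 * L"
      by (simp add: g_def algebra_simps)
    \<comment> \<open>\<open>B\<close> is nondecreasing and \<open>?s \<le> 1\<close>, so the older,
      smaller bound may be used.\<close>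
    also have "\<dots> \<le> (1 - ?s) * g (t - 1) + ?s\<^sup>2 * L"
      using s step(5)[OF t] by (intro add_mono mult_left_mono order.refl) (auto simp: g_def)
    finally show ?thesis .
  qed
  \<comment> \<open>The rate is applied at \<open>t - 1\<close> and divided by
    \<open>real (t - 1)\<close>; at \<open>t = 1\<close> it would only say that 0 is at most
    0.\<close>
  have part2: "r t = rstar" if t: "t \<ge> 2" "real t \<ge> T0" for t
  proof -
    have t1: "1 \<le> t" using t(1) by simp
    have "real (t - 1) * (real (t - 1) + 1) * g (t - 1) \<le> 4 * L * real (t - 1)"
      using open_loop_rate[of g L "t - 1", OF gap] smooth(1) by simp
    then have "real (t - 1) * (real t * g (t - 1)) \<le> real (t - 1) * (4 * L)"
      using t by (simp add: of_nat_diff mult_ac)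
    then have tg: "real t * g (t - 1) \<le> 4 * L" by (rule mult_left_le_imp_le) (use t in simp)
    \<comment> \<open>The target \<open>d (t - 1) \<le> l / 3\<close> amounts to
      \<open>18 * g (t - 1) \<le> \<mu> * l\<^sup>2\<close>; together with
      \<open>t * g (t - 1) \<le> 4 * L\<close> this explains 72 as 18 times 4.\<close>
    have "72 * L \<le> real t * (\<mu> * l\<^sup>2)"
      using t(2) growth(1) l0 by (simp add: T0_def l_def[symmetric] field_simps)
    then have "18 * (real t * g (t - 1)) \<le> real t * (\<mu> * l\<^sup>2)" using tg by simp
    then have "real t * (18 * g (t - 1)) \<le> real t * (\<mu> * l\<^sup>2)" by (simp only: mult.left_commute)
    then have "18 * g (t - 1) \<le> \<mu> * l\<^sup>2" by (rule mult_left_le_imp_le) (use t in simp)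
    then have "2 * g (t - 1) / \<mu> \<le> (l / 3)\<^sup>2"
      using growth(1) by (simp add: field_simps power2_eq_square)
    then have d3: "d (t - 1) \<le> l / 3"
      unfolding dt g_def using l0 by (intro real_le_lsqrt) simp_all
    obtain Z where Z: "Z \<in> minimizers f" "norm (X (t - 1) - Z) \<le> d (t - 1)" using near inv by blast
    note ZS = minimizers_spectrahedron[OF Z(1)]
    have "l \<le> eigval Z rstar"
      unfolding l_def min_eigval_def
      using Z(1) spectrahedron_eigval_nonneg[OF minimizers_spectrahedron]
      by (intro cINF_lower bdd_belowI2[where m=0])
    also have "\<dots> \<le> eigval (X (t - 1)) rstar + norm (Z - X (t - 1))"
      using rstar inv by (intro weyl_perturbation spectrahedron_sym ZS) auto
    also have "\<dots> \<le> eigval (X (t - 1)) rstar + d (t - 1)"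
      using Z(2) by (simp add: norm_minus_commute)
    \<comment> \<open>The eigenvalue is at least \<open>l - d (t - 1)\<close>, hence at least two
      thirds of \<open>l\<close>, whereas the radius is at most one third.\<close>
    finally have "d (t - 1) < eigval (X (t - 1)) rstar" using d3 l0 by simp
    moreover have "0 \<le> d (t - 1)" using Z(2) norm_ge_zero order_trans by blast
    ultimately have "rstar \<le> r t" unfolding r_def[OF t1] by (intro thresh_rank_geI)
    then show ?thesis using part1(2)[OF t1] by simp
  qed

  \<comment> \<open>The efficient rank catches up\<close>
  define t1 where "t1 = max 2 (nat \<lceil>T0\<rceil>)"
  have good: "r (t1 + j) = rstar" for j
    by (rule part2) (auto simp: t1_def intro: order_trans[OF real_nat_ceiling_ge])
  \<comment> \<open>From \<open>t1\<close> on the thresholding rank is \<open>rstar\<close>, so each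
    iteration raises the running maximum by at least one until it reaches \<open>rstar\<close>. The
    count starts from the maximum just before iteration \<open>t1\<close>.\<close>
  have grow: "min j rstar \<le> rbar (t1 - 1 + j)" for j
  proof (induction j)
    case (Suc j)
    have "rhat (t1 + j) = min (rbar (t1 - 1 + j) + 1) rstar"
      using part1(1)[of "t1 + j"] good[of j] by (simp add: t1_def)
    moreover have "rhat (t1 + j) \<le> rbar (t1 - 1 + Suc j)"
      unfolding rbar_def by (rule Max_ge) (auto simp: t1_def)
    ultimately show ?case using Suc by simp
  qed simp
  have T0: "0 < T0" using smooth(1) growth(1) l0 by (simp add: T0_def l_def[symmetric])
  \<comment> \<open>The new efficient rank may exceed the running maximum by one, so
    \<open>rstar - 1\<close> iterations after \<open>t1\<close> suffice. The spare iteration absorbs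
    the case in which the ceiling of \<open>T0\<close> is 1 while \<open>t1\<close> is 2.\<close>
  have part3: "rhat t = rstar" if t: "real t \<ge> T0 + real rstar" for t
  proof -
    have "T0 \<le> real (t - rstar)" "rstar < t" using t T0 by (simp_all add: of_nat_diff)
    then have "nat \<lceil>T0\<rceil> \<le> t - rstar" by (simp add: nat_le_iff ceiling_le_iff)
    moreover obtain c where c: "c = nat \<lceil>T0\<rceil>" by blast
    ultimately have j: "t1 \<le> t" "rstar \<le> t - t1 + 1"
      using \<open>rstar < t\<close> rstar(1) unfolding t1_def c[symmetric] by (auto simp: max_def)
    have "rhat t = min (rbar (t1 - 1 + (t - t1)) + 1) rstar"
      using part1(1)[of t] good[of "t - t1"] j(1) by (simp add: t1_def)
    then show ?thesis using grow[of "t - t1"] j(2) by simp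
  qed
  show ?thesis
  proof (intro conjI allI impI)
    fix t :: nat assume t: "t \<ge> 1"
    show "rhat t \<le> r t" "r t \<le> rstar" using part1[OF t] by simp_all
    assume t': "real t \<ge> T0 + real rstar"
    \<comment> \<open>\<open>T0\<close> is positive and \<open>rstar\<close> at least 1, so
      \<open>t\<close> exceeds 1 and \<open>part2\<close> applies.\<close>
    then have "t \<ge> 2" using T0 rstar(1) by linarith
    then show "r t = rstar" using part2 t' by simp
    then show "rhat t = r t" using part3[OF t'] by simp
  qed (use part2 in simp)
qed

end
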